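(* Let $\rho^{ABC}$ be any (possibly mixed) density operator on $\mathcal{H}_A\otimes\mathcal{H}_B\otimes\mathcal{H}_C$, with reduced states $\rho^{AB}$, $\rho^{CB}$, $\rho^B$. Then $$D(A|B)+J(C|B)\le S(B),$$ where $D(A|B)$ is the quantum discord of $\rho^{AB}$ and $J(C|B)$ is the classical correlation of $\rho^{CB}$, both with measurement on $B$.
   Context: All Hilbert spaces are finite-dimensional complex Hilbert spaces. A state is a density operator (positive semidefinite, trace one). Superscripts denote reduced states. The von Neumann entropy is $S(X)=-\mathrm{Tr}\,\rho^X\log_2\rho^X$. For a bipartite state $\rho^{XB}$, the mutual information is $I(X:B)=S(X)+S(B)-S(XB)$. The classical correlation (with measurement on $B$) is $$J(X|B)=\max_{\{E_i^B\}}\Big(S(X)-\sum_i p_i\,S(X|E_i^B)\Big),$$ where the maximum is over all POVMs $\{E_i^B\}$ on $\mathcal{H}_B$, $p_i=\mathrm{Tr}\big((I\otimes E_i^B)\rho^{XB}\big)$, and $S(X|E_i^B)$ is the von Neumann entropy of the post-measurement state $\rho_i^X=\mathrm{Tr}_B\big((I\otimes E_i^B)\rho^{XB}\big)/p_i$ (terms with $p_i=0$ are omitted). The quantum discord (with measurement on $B$) is $D(X|B)=I(X:B)-J(X|B)$. *)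

theory Defs
  imports "HOL-Analysis.Analysis"
begin

text \<open>
  The Hilbert space of a system with index type \<open>'n\<close> is \<open>\<complex>\<^sup>n\<close> with its standard basis, operators are
  square matrices, and the tensor product of the systems \<open>'m\<close> and \<open>'n\<close> is the system \<open>'m \<times> 'n\<close>.
\<close>

type_synonym 'n operator = "complex ^ 'n ^ 'n"

definition cinner_vec :: "complex ^ 'n::finite \<Rightarrow> complex ^ 'n \<Rightarrow> complex" where
  "cinner_vec x y = (\<Sum>i\<in>UNIV. cnj (x $ i) * y $ i)"

definition adjoint_mat :: "'n::finite operator \<Rightarrow> 'n operator" where
  "adjoint_mat A = (\<chi> i j. cnj (A $ j $ i))"

definition unitary_mat :: "'n::finite operator \<Rightarrow> bool" where
  "unitary_mat U \<longleftrightarrow> adjoint_mat U ** U = mat 1 \<and> U ** adjoint_mat U = mat 1"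

definition psd :: "'n::finite operator \<Rightarrow> bool" where
  "psd A \<longleftrightarrow> adjoint_mat A = A \<and> (\<forall>x. 0 \<le> Re (cinner_vec x (A *v x)))"

definition density_operator :: "'n::finite operator \<Rightarrow> bool" where
  "density_operator \<rho> \<longleftrightarrow> psd \<rho> \<and> trace \<rho> = 1"

definition real_diag :: "('n::finite \<Rightarrow> real) \<Rightarrow> 'n operator" where
  "real_diag d = (\<chi> i j. if i = j then of_real (d i) else 0)"

text \<open>
  Functional calculus for Hermitian matrices; the result does not depend on the chosen
  diagonalisation, see \<open>mat_fun_diag\<close> below.
\<close>

definition mat_fun :: "(real \<Rightarrow> real) \<Rightarrow> 'n::finite operator \<Rightarrow> 'n operator" where
  "mat_fun f A = (THE M. \<exists>U d. unitary_mat U \<and>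
     A = U ** real_diag d ** adjoint_mat U \<and>
     M = U ** real_diag (\<lambda>i. f (d i)) ** adjoint_mat U)"

text \<open>
  The convention \<open>0 log 0 = 0\<close> holds automatically, because \<open>log 2 0 = 0\<close> in the library.
\<close>

definition vn_entropy :: "'n::finite operator \<Rightarrow> real" where
  "vn_entropy \<rho> = - Re (trace (\<rho> ** mat_fun (log 2) \<rho>))"

definition tensor_op :: "'m::finite operator \<Rightarrow> 'n::finite operator \<Rightarrow> ('m \<times> 'n) operator" where
  "tensor_op A B = (\<chi> p q. A $ fst p $ fst q * B $ snd p $ snd q)"

definition ptrace_fst :: "('m::finite \<times> 'n::finite) operator \<Rightarrow> 'n operator" where
  "ptrace_fst \<rho> = (\<chi> j j'. \<Sum>i\<in>UNIV. \<rho> $ (i, j) $ (i, j'))"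

definition ptrace_snd :: "('m::finite \<times> 'n::finite) operator \<Rightarrow> 'm operator" where
  "ptrace_snd \<rho> = (\<chi> i i'. \<Sum>j\<in>UNIV. \<rho> $ (i, j) $ (i', j))"

definition mutual_information :: "('x::finite \<times> 'b::finite) operator \<Rightarrow> real" where
  "mutual_information \<rho> =
     vn_entropy (ptrace_snd \<rho>) + vn_entropy (ptrace_fst \<rho>) - vn_entropy \<rho>"

text \<open>A POVM with outcomes \<open>0, \<dots>, n - 1\<close>.\<close>

definition povm :: "nat \<Rightarrow> (nat \<Rightarrow> 'n::finite operator) \<Rightarrow> bool" where
  "povm n E \<longleftrightarrow> (\<forall>i<n. psd (E i)) \<and> (\<Sum>i<n. E i) = mat 1"

text \<open>All measurements below act on the second tensor factor.\<close>

definition outcome_prob :: "('x::finite \<times> 'b::finite) operator \<Rightarrow> 'b operator \<Rightarrow> real" where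
  "outcome_prob \<rho> F = Re (trace (tensor_op (mat 1) F ** \<rho>))"

definition post_state :: "('x::finite \<times> 'b::finite) operator \<Rightarrow> 'b operator \<Rightarrow> 'x operator" where
  "post_state \<rho> F = (1 / outcome_prob \<rho> F) *\<^sub>R ptrace_snd (tensor_op (mat 1) F ** \<rho>)"

definition info_gain ::
  "('x::finite \<times> 'b::finite) operator \<Rightarrow> nat \<Rightarrow> (nat \<Rightarrow> 'b operator) \<Rightarrow> real" where
  "info_gain \<rho> n E = vn_entropy (ptrace_snd \<rho>) -
     (\<Sum>i | i < n \<and> outcome_prob \<rho> (E i) \<noteq> 0.
        outcome_prob \<rho> (E i) * vn_entropy (post_state \<rho> (E i)))"

text \<open>
  For a density operator the set below is bounded above and the supremum is attained, so it is
  the maximum over all POVMs.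
\<close>

definition classical_correlation :: "('x::finite \<times> 'b::finite) operator \<Rightarrow> real" where
  "classical_correlation \<rho> = Sup {info_gain \<rho> n E | n E. povm n E}"

definition discord :: "('x::finite \<times> 'b::finite) operator \<Rightarrow> real" where
  "discord \<rho> = mutual_information \<rho> - classical_correlation \<rho>"

definition reduced_AB ::
  "('a::finite \<times> 'b::finite \<times> 'c::finite) operator \<Rightarrow> ('a \<times> 'b) operator" where
  "reduced_AB \<rho> = (\<chi> p q. \<Sum>k\<in>UNIV. \<rho> $ (fst p, snd p, k) $ (fst q, snd q, k))"

text \<open>The factors are swapped, so that the measured system \<open>B\<close> comes second.\<close>

definition reduced_CB ::
  "('a::finite \<times> 'b::finite \<times> 'c::finite) operator \<Rightarrow> ('c \<times> 'b) operator" where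
  "reduced_CB \<rho> = (\<chi> p q. \<Sum>i\<in>UNIV. \<rho> $ (i, snd p, fst p) $ (i, snd q, fst q))"

definition reduced_B :: "('a::finite \<times> 'b::finite \<times> 'c::finite) operator \<Rightarrow> 'b operator" where
  "reduced_B \<rho> = (\<chi> j j'. \<Sum>i\<in>UNIV. \<Sum>k\<in>UNIV. \<rho> $ (i, j, k) $ (i, j', k))"

lemma real_diag_mult: "(real_diag d ** A) $ i $ j = of_real (d i) * A $ i $ j"
  by (simp add: real_diag_def matrix_matrix_mult_def if_distrib if_distribR cong: if_cong)

lemma mult_real_diag: "(A ** real_diag d) $ i $ j = A $ i $ j * of_real (d j)"
  by (simp add: real_diag_def matrix_matrix_mult_def if_distrib cong: if_cong)

lemma real_diag_intertwine:
  fixes W :: "'n::finite operator"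
  assumes "W ** real_diag d = real_diag e ** W"
  shows "W ** real_diag (\<lambda>i. f (d i)) = real_diag (\<lambda>i. f (e i)) ** W"
proof -
  have "W $ i $ j * of_real (f (d j)) = of_real (f (e i)) * W $ i $ j" for i j
  proof -
    have "W $ i $ j * of_real (d j) = of_real (e i) * W $ i $ j"
      using assms real_diag_mult mult_real_diag by metis
    then show ?thesis by (cases "W $ i $ j = 0") auto
  qed
  then show ?thesis
    by (simp add: vec_eq_iff real_diag_mult mult_real_diag)
qed

lemma diagonalisation_independent:
  fixes U V :: "'n::finite operator"
  assumes U: "unitary_mat U" and V: "unitary_mat V"
    and eq: "U ** real_diag d ** adjoint_mat U = V ** real_diag e ** adjoint_mat V"
  shows "U ** real_diag (\<lambda>i. f (d i)) ** adjoint_mat U =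
         V ** real_diag (\<lambda>i. f (e i)) ** adjoint_mat V"
proof -
  let ?W = "adjoint_mat V ** U"
  have u1: "adjoint_mat U ** U = mat 1" "U ** adjoint_mat U = mat 1"
    and v1: "adjoint_mat V ** V = mat 1" "V ** adjoint_mat V = mat 1"
    using U V by (auto simp: unitary_mat_def)
  have "?W ** real_diag d = adjoint_mat V ** (U ** real_diag d ** adjoint_mat U) ** U"
    by (simp add: matrix_mul_assoc [symmetric] u1)
  also have "\<dots> = (adjoint_mat V ** V) ** real_diag e ** ?W"
    by (simp add: eq matrix_mul_assoc)
  finally have "?W ** real_diag d = real_diag e ** ?W"
    by (simp add: v1)
  then have "?W ** real_diag (\<lambda>i. f (d i)) = real_diag (\<lambda>i. f (e i)) ** ?W"
    by (rule real_diag_intertwine)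
  then have "V ** (?W ** real_diag (\<lambda>i. f (d i))) ** adjoint_mat U =
             V ** (real_diag (\<lambda>i. f (e i)) ** ?W) ** adjoint_mat U"
    by simp
  moreover have "V ** (?W ** real_diag (\<lambda>i. f (d i))) ** adjoint_mat U =
                 (V ** adjoint_mat V) ** U ** real_diag (\<lambda>i. f (d i)) ** adjoint_mat U"
    by (simp add: matrix_mul_assoc)
  moreover have "V ** (real_diag (\<lambda>i. f (e i)) ** ?W) ** adjoint_mat U =
                 V ** real_diag (\<lambda>i. f (e i)) ** adjoint_mat V ** (U ** adjoint_mat U)"
    by (simp add: matrix_mul_assoc)
  ultimately show ?thesis
    by (simp add: u1 v1)
qed

lemma mat_fun_diag:
  fixes U :: "'n::finite operator"
  assumes "unitary_mat U"
  shows "mat_fun f (U ** real_diag d ** adjoint_mat U) =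
         U ** real_diag (\<lambda>i. f (d i)) ** adjoint_mat U"
  unfolding mat_fun_def
proof (rule the_equality)
  show "\<exists>V e. unitary_mat V \<and>
     U ** real_diag d ** adjoint_mat U = V ** real_diag e ** adjoint_mat V \<and>
     U ** real_diag (\<lambda>i. f (d i)) ** adjoint_mat U =
     V ** real_diag (\<lambda>i. f (e i)) ** adjoint_mat V"
    using assms by blast
next
  fix M
  assume "\<exists>V e. unitary_mat V \<and>
     U ** real_diag d ** adjoint_mat U = V ** real_diag e ** adjoint_mat V \<and>
     M = V ** real_diag (\<lambda>i. f (e i)) ** adjoint_mat V"
  then obtain V e where "unitary_mat V"
    and "U ** real_diag d ** adjoint_mat U = V ** real_diag e ** adjoint_mat V"
    and M: "M = V ** real_diag (\<lambda>i. f (e i)) ** adjoint_mat V"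
    by blast
  then show "M = U ** real_diag (\<lambda>i. f (d i)) ** adjoint_mat U"
    unfolding M using diagonalisation_independent [OF assms] by metis
qed

end

theory Submission
  imports Defs
begin

text \<open>
  Write \<open>\<rho> = V V\<^sup>*\<close>, i.e. purify \<open>ABC\<close> by a system \<open>R\<close>. For a rank-one measurement
  of \<open>B\<close> each conditional state of \<open>ACR\<close> is pure, so the conditional states of \<open>A\<close> and
  \<open>CR\<close> have the same entropy, just as \<open>AB\<close> and \<open>CR\<close> do. The claim thereby becomes
  \<open>\<Sum>\<^sub>k D(C\<^sub>k \<parallel> C) \<le> \<Sum>\<^sub>k D(CR\<^sub>k \<parallel> CR)\<close>, the monotonicity of the relative entropy under
  the partial trace over \<open>R\<close>. Refining a POVM into rank-one elements only increases the
  information gain about \<open>C\<close>.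

  Monotonicity comes from
  \<open>l (ln l - ln m) - l + m = \<integral>\<^sub>0\<^sup>1 (1 - s) (l - m)\<^sup>2 / ((1 - s) m + s l) ds\<close>. Summed over the two
  spectra with the squared overlaps of the eigenvectors as weights, the integrand for fixed \<open>s\<close> is the
  supremum over all operators \<open>Y\<close> of
  \<open>2 Re Tr (\<sigma> - \<rho>) Y\<^sup>* - (1 - s) Tr \<sigma> Y Y\<^sup>* - s Tr \<rho> Y\<^sup>* Y\<close>. For \<open>Y \<otimes> 1\<close> this expression
  depends on the partial traces only.
\<close>

section \<open>Spectral theorem\<close>

text \<open>A version of \<open>adjoint_mat\<close> for rectangular matrices. The amplitude matrices
  of pure states, with one subsystem indexing the rows and another the columns, are rarely
  square.\<close>

definition adj :: "complex ^ 'n::finite ^ 'm::finite \<Rightarrow> complex ^ 'm ^ 'n" where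
  "adj A = (\<chi> i j. cnj (A $ j $ i))"

lemma adjoint_mat_eq_adj: "adjoint_mat = adj"
  by (simp add: adjoint_mat_def adj_def fun_eq_iff)

lemma adj_nth [simp]: "adj A $ i $ j = cnj (A $ j $ i)"
  by (simp add: adj_def)

lemma adj_adj [simp]: "adj (adj A) = A"
  by (simp add: vec_eq_iff)

lemma adj_mult: "adj (A ** B) = adj B ** adj A"
  by (simp add: vec_eq_iff matrix_matrix_mult_def mult.commute)

lemma cinner_adj: "cinner_vec (A *v x) y = cinner_vec x (adj A *v y)"
proof -
  have "cinner_vec (A *v x) y = (\<Sum>i\<in>UNIV. \<Sum>j\<in>UNIV. cnj (A $ i $ j) * cnj (x $ j) * y $ i)"
    by (simp add: cinner_vec_def matrix_vector_mult_def sum_distrib_right)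
  also have "\<dots> = (\<Sum>j\<in>UNIV. \<Sum>i\<in>UNIV. cnj (A $ i $ j) * cnj (x $ j) * y $ i)"
    by (rule sum.swap)
  also have "\<dots> = cinner_vec x (adj A *v y)"
    by (simp add: cinner_vec_def matrix_vector_mult_def sum_distrib_left mult_ac)
  finally show ?thesis .
qed

lemma cinner_add_right: "cinner_vec x (y + z) = cinner_vec x y + cinner_vec x z"
  by (simp add: cinner_vec_def ring_distribs sum.distrib)

lemma cinner_diff_right: "cinner_vec x (y - z) = cinner_vec x y - cinner_vec x z"
  by (simp add: cinner_vec_def right_diff_distrib sum_subtractf)

lemma cinner_scale_right: "cinner_vec x (c *s y) = c * cinner_vec x y"
  by (simp add: cinner_vec_def sum_distrib_left mult_ac)

lemma cinner_scaleR_right: "cinner_vec x (c *\<^sub>R y) = of_real c * cinner_vec x y"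
  by (simp add: cinner_vec_def scaleR_sum_right flip: scaleR_conv_of_real)

lemma cnj_cinner: "cnj (cinner_vec x y) = cinner_vec y x"
  by (simp add: cinner_vec_def mult.commute)

lemma Re_cinner: "Re (cinner_vec x y) = x \<bullet> y"
  by (simp add: cinner_vec_def inner_vec_def inner_complex_def)

lemma cinner_self: "cinner_vec x x = of_real ((norm x)\<^sup>2)"
proof -
  have "Im (cinner_vec x x) = 0"
    by (simp add: cinner_vec_def)
  moreover have "Re (cinner_vec x x) = (norm x)\<^sup>2"
    by (simp add: Re_cinner power2_norm_eq_inner)
  ultimately show ?thesis by (simp add: complex_eq_iff)
qed

section \<open>Eigenvectors of Hermitian operators\<close>

lemma linear_coeff_zero_of_quadratic_bound:
  fixes b c :: real
  assumes "\<And>t. t * b \<le> t\<^sup>2 * c"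
  shows "b = 0"
proof (rule ccontr)
  assume b: "b \<noteq> 0"
  \<comment> \<open>With this \<open>t\<close> the quadratic bound
    \<open>t\<^sup>2 * (\<bar>c\<bar> + 1)\<close> is exactly half of the linear term
    \<open>t * b\<close>, which is positive.\<close>
  define t where "t = b / (2 * (\<bar>c\<bar> + 1))"
  have "t * b \<le> t\<^sup>2 * c" by (rule assms)
  also have "\<dots> \<le> t\<^sup>2 * (\<bar>c\<bar> + 1)" by (intro mult_left_mono) auto
  also have "\<dots> = t * b / 2" by (simp add: t_def power2_eq_square field_simps add_nonneg_eq_0_iff)
  finally have "t * b \<le> 0" by linarith
  moreover have "t * b = b\<^sup>2 / (2 * (\<bar>c\<bar> + 1))" by (simp add: t_def power2_eq_square)
  moreover have "\<dots> > 0" using b by (intro divide_pos_pos) auto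
  ultimately show False by simp
qed

text \<open>A maximiser \<open>x\<close> of the quadratic form on the unit sphere of
  \<open>P\<close> is an eigenvector. The residual \<open>y = A *v x - l *\<^sub>R x\<close> lies in
  \<open>P\<close> by invariance, and moving \<open>x\<close> along \<open>y\<close> changes
  \<open>x \<bullet> (A *v x) - l * (x \<bullet> x)\<close> to first order by
  \<open>2 * (y \<bullet> y)\<close>, which must vanish at a maximum.\<close>

lemma hermitian_eigenvector_on_subspace:
  fixes A :: "'n::finite operator" and P :: "(complex ^ 'n) set"
  assumes A: "adj A = A" and P: "subspace P" and inv: "\<And>x. x \<in> P \<Longrightarrow> A *v x \<in> P"
    and ne: "z \<in> P" "z \<noteq> 0"
  shows "\<exists>x\<in>P. \<exists>l::real. norm x = 1 \<and> A *v x = l *\<^sub>R x"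
proof -
  let ?T = "P \<inter> sphere 0 1"
  have "compact ?T" using P by (simp add: closed_Int_compact closed_subspace)
  moreover have "(1 / norm z) *\<^sub>R z \<in> ?T" using ne P by (simp add: subspace_scale)
  moreover have "continuous_on ?T (\<lambda>x. x \<bullet> (A *v x))"
    by (intro continuous_intros linear_continuous_on matrix_vector_mul_bounded_linear)
  ultimately obtain x where x: "x \<in> ?T" and mx: "\<And>y. y \<in> ?T \<Longrightarrow> y \<bullet> (A *v y) \<le> x \<bullet> (A *v x)"
    using continuous_attains_sup[of ?T "\<lambda>x. x \<bullet> (A *v x)"] by blast
  define l where "l = x \<bullet> (A *v x)"
  have AscR: "A *v (c *\<^sub>R y) = c *\<^sub>R (A *v y)" for c y
    by (simp add: linear_scale)
  have mx': "y \<bullet> (A *v y) \<le> l * (y \<bullet> y)" if "y \<in> P" for y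
  proof (cases "y = 0")
    case False
    then have "(1 / norm y) *\<^sub>R y \<in> ?T" using that P by (simp add: subspace_scale)
    from mx[OF this] have "(y \<bullet> (A *v y)) / (norm y)\<^sup>2 \<le> l"
      by (simp add: AscR l_def power2_eq_square)
    then show ?thesis using False
      by (simp add: divide_le_eq power2_norm_eq_inner)
  qed simp
  have sym: "y \<bullet> (A *v w) = w \<bullet> (A *v y)" for y w
    by (metis A Re_cinner cinner_adj inner_commute)
  define y where "y = A *v x - l *\<^sub>R x"
  have yP: "y \<in> P" using x P inv by (auto simp: y_def intro!: subspace_diff subspace_scale)
  have "t * (2 * (y \<bullet> y)) \<le> t\<^sup>2 * (l * (y \<bullet> y) - y \<bullet> (A *v y))" for t
  proof -
    have "x + t *\<^sub>R y \<in> P" using x yP P by (auto intro!: subspace_add subspace_scale)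
    from mx'[OF this]
    have "x \<bullet> (A *v x) + 2 * t * (y \<bullet> (A *v x)) + t\<^sup>2 * (y \<bullet> (A *v y))
        \<le> l * (x \<bullet> x + 2 * t * (y \<bullet> x) + t\<^sup>2 * (y \<bullet> y))"
      by (simp add: matrix_vector_right_distrib AscR inner_add_left inner_add_right
          sym[of x y] inner_commute[of x y] power2_eq_square algebra_simps)
    moreover have "x \<bullet> x = 1" using x by (simp add: power2_norm_eq_inner[symmetric])
    ultimately have le: "l + 2 * t * (y \<bullet> (A *v x)) + t\<^sup>2 * (y \<bullet> (A *v y))
        \<le> l + 2 * t * l * (y \<bullet> x) + t\<^sup>2 * l * (y \<bullet> y)"
      by (simp add: l_def algebra_simps)
    have "y \<bullet> y = y \<bullet> (A *v x) - l * (y \<bullet> x)"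
      by (subst (2) y_def) (simp add: inner_diff_right)
    then have "t * (2 * (y \<bullet> y)) = 2 * t * (y \<bullet> (A *v x)) - 2 * t * l * (y \<bullet> x)"
      by (simp only:) (simp add: algebra_simps)
    then show ?thesis using le by (simp add: right_diff_distrib mult.assoc)
  qed
  then have "2 * (y \<bullet> y) = 0" by (rule linear_coeff_zero_of_quadratic_bound)
  then have "A *v x = l *\<^sub>R x" by (simp add: y_def)
  then show ?thesis using x by auto
qed

text \<open>Induction on \<open>I\<close>: the orthogonal complement of the eigenvectors found so
  far is invariant because \<open>A\<close> is Hermitian, and it is nonzero as long as fewer vectors
  than the dimension have been chosen.\<close>

lemma orthonormal_eigenvectors:
  fixes A :: "'n::finite operator" and I :: "'n set"
  assumes A: "adj A = A"
  shows "\<exists>v d. (\<forall>i\<in>I. A *v v i = (d i :: real) *\<^sub>R v i) \<and>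
     (\<forall>i\<in>I. \<forall>j\<in>I. cinner_vec (v i) (v j) = (if i = j then 1 else 0))"
  using finite[of I]
proof (induction I rule: finite_induct)
  case empty
  then show ?case by simp
next
  case (insert a I)
  then obtain v d where ev: "\<And>i. i \<in> I \<Longrightarrow> A *v v i = (d i :: real) *\<^sub>R v i"
    and on: "\<And>i j. i \<in> I \<Longrightarrow> j \<in> I \<Longrightarrow> cinner_vec (v i) (v j) = (if i = j then 1 else 0)"
    by blast
  define P where "P = {x. \<forall>i\<in>I. cinner_vec (v i) x = 0}"
  have "card I < CARD('n)" using insert.hyps
    by (metis UNIV_I finite psubsetI psubset_card_mono subset_UNIV)
  \<comment> \<open>\<open>dim\<close> and \<open>orthogonal\<close> refer to the real structure, of
    dimension \<open>2 * CARD('n)\<close>. Orthogonality to both \<open>v i\<close> and its multiple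
    by the imaginary unit kills the real and the imaginary part of the complex inner
    product.\<close>
  let ?S = "v ` I \<union> (\<lambda>i. \<i> *s v i) ` I"
  have "dim ?S \<le> card ?S" by (intro dim_le_card') auto
  also have "\<dots> \<le> card I + card I"
    by (intro order.trans[OF card_Un_le] add_mono card_image_le) auto
  also have "\<dots> < DIM(complex ^ 'n)" using \<open>card I < CARD('n)\<close> by simp
  finally obtain z where z: "z \<noteq> 0" "\<And>y. y \<in> span ?S \<Longrightarrow> orthogonal z y"
    by (rule orthogonal_to_subspace_exists) blast
  have "cinner_vec (v i) z = 0" if "i \<in> I" for i
  proof -
    have "orthogonal z (v i)" "orthogonal z (\<i> *s v i)" using that by (auto intro!: z span_base)
    then have "Re (cinner_vec z (v i)) = 0" "Re (cinner_vec z (\<i> *s v i)) = 0"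
      by (auto simp: Re_cinner orthogonal_def)
    then have "cinner_vec z (v i) = 0" by (simp add: cinner_scale_right complex_eq_iff)
    then show ?thesis by (metis cnj_cinner complex_cnj_zero)
  qed
  then have zP: "z \<in> P" by (simp add: P_def)
  have "subspace P"
    by (simp add: P_def subspace_def cinner_add_right cinner_scaleR_right) (simp add: cinner_vec_def)
  moreover have "A *v x \<in> P" if "x \<in> P" for x
  proof -
    have "cinner_vec (v i) (A *v x) = 0" if "i \<in> I" for i
    proof -
      have "cinner_vec (v i) (A *v x) = cinner_vec (A *v v i) x" by (simp add: cinner_adj A)
      also have "\<dots> = cnj (of_real (d i) * cinner_vec x (v i))"
        using that by (simp only: ev cnj_cinner flip: cinner_scaleR_right)
      also have "\<dots> = 0" using \<open>x \<in> P\<close> that by (simp add: P_def cnj_cinner)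
      finally show ?thesis .
    qed
    then show ?thesis by (simp add: P_def)
  qed
  ultimately obtain x l where x: "x \<in> P" "norm x = 1" "A *v x = (l::real) *\<^sub>R x"
    using hermitian_eigenvector_on_subspace[OF A _ _ zP z(1)] by blast
  have x0: "cinner_vec (v i) x = 0" "cinner_vec x (v i) = 0" if "i \<in> I" for i
    using x(1) that cnj_cinner[of "v i" x] by (auto simp: P_def)
  have "cinner_vec x x = 1" using x(2) by (simp add: cinner_self)
  then show ?case
    using insert.hyps ev on x x0
    by (intro exI[of _ "v(a := x)"] exI[of _ "d(a := l)"]) auto
qed

lemma unitary_mat_adj: "unitary_mat U \<longleftrightarrow> adj U ** U = mat 1 \<and> U ** adj U = mat 1"
  by (simp add: unitary_mat_def adjoint_mat_eq_adj)

theorem hermitian_diagonalisation: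
  fixes A :: "'n::finite operator"
  assumes A: "adj A = A"
  obtains U d where "unitary_mat U" "A = U ** real_diag d ** adj U"
proof -
  obtain v d where ev: "\<And>i. A *v v i = (d i :: real) *\<^sub>R v i"
    and on: "\<And>i j. cinner_vec (v i) (v j) = (if i = (j::'n) then 1 else 0)"
    using orthonormal_eigenvectors[OF A, of UNIV] by auto
  define U :: "'n operator" where "U = (\<chi> i j. v j $ i)"
  have 1: "adj U ** U = mat 1"
    using on by (simp add: vec_eq_iff U_def matrix_matrix_mult_def cinner_vec_def mat_def)
  then have 2: "U ** adj U = mat 1" by (simp add: matrix_left_right_inverse)
  have "A ** U = U ** real_diag d"
  proof -
    have "(A ** U) $ i $ j = (A *v v j) $ i" for i j
      by (simp add: U_def matrix_matrix_mult_def matrix_vector_mult_def)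
    then show ?thesis
      by (simp add: vec_eq_iff mult_real_diag ev) (simp add: U_def scaleR_conv_of_real mult.commute)
  qed
  then have "A ** (U ** adj U) = U ** real_diag d ** adj U"
    by (simp add: matrix_mul_assoc)
  then show ?thesis using that 1 2 by (simp add: unitary_mat_adj)
qed

section \<open>Entropy and spectra\<close>

lemma unitary_mat_adj_mult:
  assumes "unitary_mat U" "unitary_mat V"
  shows "unitary_mat (adj V ** U)"
proof -
  have "adj U ** (V ** adj V) ** U = mat 1" "adj V ** (U ** adj U) ** V = mat 1"
    using assms by (simp_all add: unitary_mat_adj)
  then show ?thesis by (simp add: unitary_mat_adj adj_mult matrix_mul_assoc)
qed

lemma gram_nth: "(A ** adj A) $ i $ j = (\<Sum>k\<in>UNIV. A $ i $ k * cnj (A $ j $ k))"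
  by (simp add: matrix_matrix_mult_def)

lemma adj_gram_nth: "(adj A ** A) $ i $ j = (\<Sum>k\<in>UNIV. cnj (A $ k $ i) * A $ k $ j)"
  by (simp add: matrix_matrix_mult_def)

lemma of_real_cmod_square: "(of_real (cmod z))\<^sup>2 = z * cnj z"
  by (simp add: complex_norm_square flip: of_real_power)

lemma sum_norm_row: "of_real (\<Sum>k\<in>UNIV. (cmod (A $ i $ k))\<^sup>2) = (A ** adj A) $ i $ i"
  by (simp add: gram_nth of_real_cmod_square)

lemma sum_norm_col: "of_real (\<Sum>k\<in>UNIV. (cmod (A $ k $ i))\<^sup>2) = (adj A ** A) $ i $ i"
  by (simp add: adj_gram_nth of_real_cmod_square mult.commute)

lemma unitary_sum_norm:
  assumes "unitary_mat U"
  shows "(\<Sum>k\<in>UNIV. (cmod (U $ i $ k))\<^sup>2) = 1" "(\<Sum>k\<in>UNIV. (cmod (U $ k $ i))\<^sup>2) = 1"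
proof -
  have "of_real (\<Sum>k\<in>UNIV. (cmod (U $ i $ k))\<^sup>2) = (1 :: complex)"
    unfolding sum_norm_row using assms by (simp add: unitary_mat_adj mat_def)
  then show "(\<Sum>k\<in>UNIV. (cmod (U $ i $ k))\<^sup>2) = 1"
    by (simp only: of_real_eq_1_iff)
  have "of_real (\<Sum>k\<in>UNIV. (cmod (U $ k $ i))\<^sup>2) = (1 :: complex)"
    unfolding sum_norm_col using assms by (simp add: unitary_mat_adj mat_def)
  then show "(\<Sum>k\<in>UNIV. (cmod (U $ k $ i))\<^sup>2) = 1"
    by (simp only: of_real_eq_1_iff)
qed

lemma trace_unitary_conj:
  assumes "unitary_mat U"
  shows "trace (U ** A ** adj U) = trace A"
proof -
  have "trace (U ** A ** adj U) = trace (adj U ** U ** A)"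
    by (simp add: trace_mul_sym[of "U ** A"] matrix_mul_assoc)
  then show ?thesis using assms by (simp add: unitary_mat_adj)
qed

lemma trace_real_diag: "trace (real_diag d) = of_real (\<Sum>i\<in>UNIV. d i)"
  by (simp add: trace_def real_diag_def)

lemma mat_fun_eig:
  assumes "unitary_mat U"
  shows "mat_fun f (U ** real_diag d ** adj U) = U ** real_diag (\<lambda>i. f (d i)) ** adj U"
  using mat_fun_diag[OF assms] by (simp add: adjoint_mat_eq_adj)

text \<open>By cyclicity only the overlap matrix \<open>adj V ** U\<close> of the two eigenbases
  remains. Its squared moduli form a doubly stochastic matrix, by \<open>unitary_sum_norm\<close>;
  they are the weights in all later double sums over two spectra.\<close>

lemma trace_mult_eig:
  assumes "unitary_mat U" "unitary_mat V"
  shows "trace (U ** real_diag d ** adj U ** (V ** real_diag e ** adj V)) =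
    of_real (\<Sum>i\<in>UNIV. \<Sum>j\<in>UNIV. (cmod ((adj V ** U) $ j $ i))\<^sup>2 * (d i * e j))"
proof -
  let ?g = "adj V ** U"
  have "U ** real_diag d ** adj U ** (V ** real_diag e ** adj V) =
      U ** real_diag d ** (adj ?g ** real_diag e ** adj V)"
    by (simp add: adj_mult matrix_mul_assoc)
  then have "trace (U ** real_diag d ** adj U ** (V ** real_diag e ** adj V)) =
      trace (adj ?g ** real_diag e ** adj V ** (U ** real_diag d))"
    by (simp only: trace_mul_sym[of "U ** real_diag d"])
  also have "\<dots> = trace (adj ?g ** real_diag e ** (?g ** real_diag d))"
    by (simp add: matrix_mul_assoc)
  also have "\<dots> = (\<Sum>i\<in>UNIV. \<Sum>j\<in>UNIV. cnj (?g $ j $ i) * e j * (?g $ j $ i * d i))"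
    unfolding trace_def matrix_matrix_mult_def[of "adj ?g ** real_diag e"]
    by (simp add: mult_real_diag)
  also have "\<dots> = of_real (\<Sum>i\<in>UNIV. \<Sum>j\<in>UNIV. (cmod (?g $ j $ i))\<^sup>2 * (d i * e j))"
    by (simp add: of_real_cmod_square mult_ac)
  finally show ?thesis .
qed

lemma vn_entropy_eig:
  assumes "unitary_mat U"
  shows "vn_entropy (U ** real_diag d ** adj U) = - (\<Sum>i\<in>UNIV. d i * log 2 (d i))"
proof -
  have "U ** real_diag d ** adj U ** (U ** real_diag (\<lambda>i. log 2 (d i)) ** adj U) =
      U ** real_diag d ** (adj U ** U) ** real_diag (\<lambda>i. log 2 (d i)) ** adj U"
    by (simp add: matrix_mul_assoc)
  also have "\<dots> = U ** (real_diag d ** real_diag (\<lambda>i. log 2 (d i))) ** adj U"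
    using assms by (simp add: unitary_mat_adj matrix_mul_assoc)
  also have "real_diag d ** real_diag (\<lambda>i. log 2 (d i)) = real_diag (\<lambda>i. d i * log 2 (d i))"
    by (simp add: vec_eq_iff real_diag_mult) (simp add: real_diag_def)
  finally show ?thesis
    by (simp add: vn_entropy_def mat_fun_eig[OF assms] trace_unitary_conj[OF assms] trace_real_diag)
qed

section \<open>Positive operators as Gram matrices\<close>

lemma quadratic_form_gram: "cinner_vec x ((L ** adj L) *v x) = of_real ((norm (adj L *v x))\<^sup>2)"
  by (simp add: matrix_vector_mul_assoc[symmetric] cinner_adj[of "adj L", simplified, symmetric] cinner_self)

lemma psd_gram: "psd (L ** adj L)"
  by (simp add: psd_def adjoint_mat_eq_adj adj_mult quadratic_form_gram)

lemma psd_adj: "psd M \<Longrightarrow> adj M = M"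
  by (simp add: psd_def adjoint_mat_eq_adj)

lemma quadratic_form_column:
  "cinner_vec (column j U) (M *v column j U) = (adj U ** M ** U) $ j $ j"
proof -
  have "(adj U ** M ** U) $ j $ j = (adj U ** (M ** U)) $ j $ j"
    by (simp add: matrix_mul_assoc)
  also have "\<dots> = cinner_vec (column j U) (M *v column j U)"
    unfolding matrix_matrix_mult_def[of "adj U"]
    by (simp add: matrix_matrix_mult_def cinner_vec_def matrix_vector_mult_def column_def)
  finally show ?thesis ..
qed

lemma eig_nth:
  assumes "unitary_mat U"
  shows "d j = Re (cinner_vec (column j U) ((U ** real_diag d ** adj U) *v column j U))"
proof -
  have 1: "adj U ** (U ** real_diag d ** adj U) ** U = real_diag d"
  proof -
    have "adj U ** (U ** real_diag d ** adj U) ** U = (adj U ** U) ** real_diag d ** (adj U ** U)"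
      by (simp add: matrix_mul_assoc)
    then show ?thesis using assms by (simp add: unitary_mat_adj)
  qed
  show ?thesis by (simp add: quadratic_form_column 1) (simp add: real_diag_def)
qed

lemma psd_diagonalisation:
  assumes "psd M"
  obtains U d where "unitary_mat U" "M = U ** real_diag d ** adj U" "\<forall>i. 0 \<le> d i"
proof -
  obtain U d where U: "unitary_mat U" "M = U ** real_diag d ** adj U"
    using hermitian_diagonalisation psd_adj[OF assms] by blast
  moreover have "0 \<le> d i" for i
    using assms eig_nth[OF U(1), of d i] by (simp add: psd_def U(2)[symmetric])
  ultimately show ?thesis using that by blast
qed

text \<open>The factor is the eigenbasis scaled by the square roots of the eigenvalues. It serves as
  a purification whose auxiliary system is the column index of \<open>G\<close>.\<close>

lemma psd_eq_gram:
  fixes M :: "'n::finite operator"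
  assumes "psd M"
  obtains G :: "'n operator" where "M = G ** adj G"
proof -
  obtain U d where U: "unitary_mat U" "M = U ** real_diag d ** adj U" "\<forall>i. 0 \<le> d i"
    by (rule psd_diagonalisation[OF assms])
  have sq: "of_real (sqrt (d k)) * (of_real (sqrt (d k)) * x) = of_real (d k) * x" for k and x :: complex
    using U(3) by (simp add: mult.assoc[symmetric] flip: of_real_mult)
  have "M $ i $ j = ((U ** real_diag (\<lambda>i. sqrt (d i))) ** adj (U ** real_diag (\<lambda>i. sqrt (d i)))) $ i $ j" for i j
    unfolding gram_nth mult_real_diag U(2) matrix_matrix_mult_def[of "U ** real_diag d"]
    by (simp add: mult_real_diag mult_ac sq)
  then have "M = U ** real_diag (\<lambda>i. sqrt (d i)) ** adj (U ** real_diag (\<lambda>i. sqrt (d i)))"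
    by (simp add: vec_eq_iff)
  then show ?thesis by (rule that)
qed

text \<open>Both products have the same nonzero spectrum. Multiplicities need no matching:
  \<open>d i\<close> and \<open>e j\<close> agree wherever \<open>K $ j $ i\<close> is nonzero, so
  both entropies equal one and the same double sum over the squared moduli of \<open>K\<close>,
  summed in two orders.\<close>

lemma vn_entropy_gram_swap: "vn_entropy (W ** adj W) = vn_entropy (adj W ** W)"
proof -
  obtain U d where U: "unitary_mat U" "W ** adj W = U ** real_diag d ** adj U"
    by (rule hermitian_diagonalisation[of "W ** adj W"]) (simp_all add: adj_mult)
  obtain V e where V: "unitary_mat V" "adj W ** W = V ** real_diag e ** adj V"
    by (rule hermitian_diagonalisation[of "adj W ** W"]) (simp_all add: adj_mult)
  \<comment> \<open>\<open>K\<close> intertwines the two spectra; its squared moduli have them as column and row sums.\<close>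
  define K where "K = adj V ** adj W ** U"
  have u: "adj U ** U = mat 1" "U ** adj U = mat 1" "adj V ** V = mat 1" "V ** adj V = mat 1"
    using U V by (auto simp: unitary_mat_adj)
  have KK: "adj K ** K = real_diag d"
  proof -
    have "adj K ** K = adj U ** W ** (V ** adj V) ** adj W ** U"
      by (simp add: K_def adj_mult matrix_mul_assoc)
    also have "\<dots> = adj U ** (W ** adj W) ** U" by (simp add: u matrix_mul_assoc)
    also have "\<dots> = (adj U ** U) ** real_diag d ** (adj U ** U)"
      by (simp add: U matrix_mul_assoc)
    finally show ?thesis by (simp add: u)
  qed
  have KK': "K ** adj K = real_diag e"
  proof -
    have "K ** adj K = adj V ** adj W ** (U ** adj U) ** W ** V"
      by (simp add: K_def adj_mult matrix_mul_assoc)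
    also have "\<dots> = adj V ** (adj W ** W) ** V" by (simp add: u matrix_mul_assoc)
    also have "\<dots> = (adj V ** V) ** real_diag e ** (adj V ** V)"
      by (simp add: V matrix_mul_assoc)
    finally show ?thesis by (simp add: u)
  qed
  have "K ** real_diag d = real_diag e ** K"
    by (simp add: matrix_mul_assoc flip: KK KK')
  then have "K $ j $ i * of_real (d i) = of_real (e j) * K $ j $ i" for i j
    by (metis mult_real_diag real_diag_mult)
  then have "d i = e j" if "K $ j $ i \<noteq> 0" for i j
    using that by (metis mult.commute mult_left_cancel of_real_eq_iff)
  then have eq: "(cmod (K $ j $ i))\<^sup>2 * log 2 (d i) = (cmod (K $ j $ i))\<^sup>2 * log 2 (e j)" for i j
    by (metis mult_zero_left norm_zero zero_power2)
  have d: "d i = (\<Sum>j\<in>UNIV. (cmod (K $ j $ i))\<^sup>2)" for i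
    using sum_norm_col[of K i] by (simp add: KK real_diag_def del: of_real_sum of_real_power)
  have e: "e j = (\<Sum>i\<in>UNIV. (cmod (K $ j $ i))\<^sup>2)" for j
    using sum_norm_row[of K j] by (simp add: KK' real_diag_def del: of_real_sum of_real_power)
  have "(\<Sum>i\<in>UNIV. d i * log 2 (d i)) = (\<Sum>i\<in>UNIV. \<Sum>j\<in>UNIV. (cmod (K $ j $ i))\<^sup>2 * log 2 (d i))"
    by (subst (1) d) (simp add: sum_distrib_right)
  also have "\<dots> = (\<Sum>j\<in>UNIV. \<Sum>i\<in>UNIV. (cmod (K $ j $ i))\<^sup>2 * log 2 (e j))"
    unfolding eq by (rule sum.swap)
  also have "\<dots> = (\<Sum>j\<in>UNIV. e j * log 2 (e j))"
    by (subst (2) e) (simp add: sum_distrib_right)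
  finally show ?thesis by (simp add: U V vn_entropy_eig)
qed

text \<open>The spectrum stays the same, while the eigenbasis is replaced by its entrywise complex
  conjugate \<open>transpose (adj U)\<close>.\<close>

lemma vn_entropy_transpose:
  assumes "adj M = M"
  shows "vn_entropy (transpose M) = vn_entropy M"
proof -
  obtain U d where U: "unitary_mat U" "M = U ** real_diag d ** adj U"
    using hermitian_diagonalisation[OF assms] .
  let ?V = "transpose (adj U)"
  have aV: "adj ?V = transpose U" by (simp add: vec_eq_iff transpose_def)
  have "unitary_mat ?V"
    using U(1) unfolding unitary_mat_adj aV by (simp flip: matrix_transpose_mul)
  moreover have "transpose (real_diag d) = real_diag d"
    by (simp add: vec_eq_iff transpose_def real_diag_def)
  then have "transpose M = ?V ** real_diag d ** adj ?V"
    unfolding aV by (simp add: U(2) matrix_transpose_mul matrix_mul_assoc)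
  ultimately show ?thesis by (simp add: U vn_entropy_eig)
qed

section \<open>Relative entropy of unnormalised operators\<close>

definition rel_entropy :: "'n::finite operator \<Rightarrow> 'n operator \<Rightarrow> real" where
  "rel_entropy \<rho> \<sigma> = - vn_entropy \<rho> - Re (trace (\<rho> ** mat_fun (log 2) \<sigma>))"

text \<open>With \<open>w\<close> for the squared overlaps, this is the classical relative entropy
  of the joint weights \<open>w * d i\<close> and \<open>w * e j\<close>. The entropy term becomes a
  double sum because the weights belonging to each \<open>i\<close> add up to 1.\<close>

lemma rel_entropy_eig:
  assumes "unitary_mat U" "unitary_mat V"
  shows "rel_entropy (U ** real_diag d ** adj U) (V ** real_diag e ** adj V) =
    (\<Sum>i\<in>UNIV. \<Sum>j\<in>UNIV. (cmod ((adj V ** U) $ j $ i))\<^sup>2 * (d i * (log 2 (d i) - log 2 (e j))))"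
proof -
  let ?g = "adj V ** U"
  have "(\<Sum>i\<in>UNIV. d i * log 2 (d i)) =
      (\<Sum>i\<in>UNIV. (\<Sum>j\<in>UNIV. (cmod (?g $ j $ i))\<^sup>2) * (d i * log 2 (d i)))"
    by (simp add: unitary_sum_norm unitary_mat_adj_mult assms)
  then show ?thesis
    by (simp add: rel_entropy_def vn_entropy_eig mat_fun_eig assms trace_mult_eig
        right_diff_distrib sum_subtractf sum_distrib_right)
qed

text \<open>The kernel of \<open>\<sigma>\<close> lies in the kernel of \<open>\<rho>\<close> when \<open>\<rho> \<le> \<sigma>\<close>, so the junk value \<open>log 2 0 = 0\<close> does no harm.\<close>

lemma eig_support:
  assumes U: "unitary_mat U" and V: "unitary_mat V" and d: "\<And>i. 0 \<le> d i" and e: "e j = 0"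
    and le: "psd (V ** real_diag e ** adj V - U ** real_diag d ** adj U)"
  shows "(adj V ** U) $ j $ i = 0 \<or> d i = 0"
proof -
  let ?s = "V ** real_diag e ** adj V" and ?r = "U ** real_diag d ** adj U" and ?v = "column j V"
  \<comment> \<open>Test the order on an eigenvector of the larger operator for the eigenvalue 0:
    what remains is minus a sum of nonnegative terms, so each of them vanishes.\<close>
  have "0 \<le> Re (cinner_vec ?v ((?s - ?r) *v ?v))"
    using le by (simp add: psd_def)
  also have "\<dots> = - Re (cinner_vec ?v (?r *v ?v))"
    using eig_nth[OF V, of e j] e by (simp add: matrix_vector_mult_diff_rdistrib cinner_diff_right)
  also have "cinner_vec ?v (?r *v ?v) = (adj V ** ?r ** V) $ j $ j"
    by (rule quadratic_form_column)
  also have "adj V ** ?r ** V = adj V ** U ** real_diag d ** adj (adj V ** U)"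
    by (simp add: adj_mult matrix_mul_assoc)
  also have "Re (\<dots> $ j $ j) = (\<Sum>i\<in>UNIV. (cmod ((adj V ** U) $ j $ i))\<^sup>2 * d i)"
  proof -
    have "(adj V ** U ** real_diag d ** adj (adj V ** U)) $ j $ j =
       of_real (\<Sum>i\<in>UNIV. (cmod ((adj V ** U) $ j $ i))\<^sup>2 * d i)"
      unfolding matrix_matrix_mult_def[of "adj V ** U ** real_diag d"]
      by (simp add: mult_real_diag of_real_cmod_square mult_ac)
    then show ?thesis by simp
  qed
  finally have "(\<Sum>i\<in>UNIV. (cmod ((adj V ** U) $ j $ i))\<^sup>2 * d i) \<le> 0" by simp
  then have "(\<Sum>i\<in>UNIV. (cmod ((adj V ** U) $ j $ i))\<^sup>2 * d i) = 0"
    by (intro antisym sum_nonneg) (auto simp: d)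
  then have "(cmod ((adj V ** U) $ j $ i))\<^sup>2 * d i = 0"
    using d by (subst (asm) sum_nonneg_eq_0_iff) auto
  then show ?thesis by auto
qed

section \<open>Monotonicity of the relative entropy\<close>

lemma has_integral_relative_entropy_kernel:
  fixes l m :: real
  assumes "0 \<le> l" "0 \<le> m" "m = 0 \<Longrightarrow> l = 0"
  shows "((\<lambda>s. (1 - s) * ((l - m)\<^sup>2 / ((1 - s) * m + s * l))) has_integral
           (l * (ln l - ln m) - l + m)) {0..1}"
proof -
  consider "l = 0" "m = 0" | "l = 0" "m > 0" | "l > 0" "m > 0"
    using assms by fastforce
  then show ?thesis
  proof cases
    case 1
    then show ?thesis by simp
  next
    case 2
    \<comment> \<open>For \<open>l = 0\<close> the integrand is the constant \<open>m\<close> except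
      at \<open>s = 1\<close>, where it is 0.\<close>
    have "((\<lambda>s. m) has_integral m) {0..1::real}"
      using has_integral_const_real[of m 0 1] by simp
    then have "((\<lambda>s. (1 - s) * ((l - m)\<^sup>2 / ((1 - s) * m + s * l))) has_integral m) {0..1}"
      by (rule has_integral_spike[of "{1}", rotated 2])
        (use 2 in \<open>auto simp: power2_eq_square\<close>)
    then show ?thesis using 2 by simp
  next
    case 3
    define q where "q s = (1 - s) * m + s * l" for s
    have q: "q s > 0" if "s \<in> {0..1}" for s
    proof (cases "s = 0")
      case False
      then show ?thesis using 3 that unfolding q_def by (intro add_nonneg_pos) auto
    qed (use 3 in \<open>simp add: q_def\<close>)
    \<comment> \<open>Taylor's formula with integral remainder for \<open>q s * ln (q s)\<close>:
      its second derivative is \<open>(l - m)\<^sup>2 / q s\<close>, and \<open>?F\<close> is the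
      function itself plus \<open>1 - s\<close> times its first derivative.\<close>
    let ?F = "\<lambda>s. (1 - s) * ((ln (q s) + 1) * (l - m)) + q s * ln (q s)"
    have "((\<lambda>s. (1 - s) * ((l - m)\<^sup>2 / q s)) has_integral (?F 1 - ?F 0)) {0..1}"
    proof (rule fundamental_theorem_of_calculus)
      fix s :: real
      assume "s \<in> {0..1}"
      note qs = q[OF this]
      have dq: "(q has_real_derivative (l - m)) (at s within {0..1})"
        unfolding q_def by (auto intro!: derivative_eq_intros)
      have "(?F has_real_derivative (1 - s) * ((l - m)\<^sup>2 / q s)) (at s within {0..1})"
        using qs by (auto intro!: derivative_eq_intros dq simp: field_simps power2_eq_square)
      then show "(?F has_vector_derivative (1 - s) * ((l - m)\<^sup>2 / q s)) (at s within {0..1})"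
        by (simp add: has_real_derivative_iff_has_vector_derivative)
    qed simp
    then show ?thesis
      by (simp add: q_def algebra_simps)
  qed
qed

text \<open>A chi-square divergence: for the joint weights \<open>P = w * d i\<close> and
  \<open>Q = w * e j\<close>, with \<open>w\<close> the squared overlaps, it sums
  \<open>(P - Q)\<^sup>2\<close> over the mixture \<open>(1 - s) * Q + s * P\<close>.\<close>

definition overlap_form ::
  "real \<Rightarrow> 'n::finite operator \<Rightarrow> ('n \<Rightarrow> real) \<Rightarrow> ('n \<Rightarrow> real) \<Rightarrow> real" where
  "overlap_form s g d e = (\<Sum>i\<in>UNIV. \<Sum>j\<in>UNIV.
     (cmod (g $ j $ i))\<^sup>2 * ((d i - e j)\<^sup>2 / ((1 - s) * e j + s * d i)))"

text \<open>The order of \<open>Y\<close> and \<open>adj Y\<close> differs in the two quadratic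
  terms, so that \<sigma> acts on the row index and \<rho> on the column index of \<open>Y\<close>.
  An entry of \<open>Y\<close> in the two eigenbases then has the quadratic coefficient
  \<open>(1 - s) * e j + s * d i\<close>.\<close>

definition variational_form ::
  "real \<Rightarrow> 'n::finite operator \<Rightarrow> 'n operator \<Rightarrow> 'n operator \<Rightarrow> real" where
  "variational_form s \<rho> \<sigma> Y = 2 * Re (trace ((\<sigma> - \<rho>) ** adj Y))
     - (1 - s) * Re (trace (\<sigma> ** (Y ** adj Y))) - s * Re (trace (\<rho> ** (adj Y ** Y)))"

lemma variational_form_eig:
  assumes U: "unitary_mat U" and V: "unitary_mat V"
  shows "variational_form s (U ** real_diag d ** adj U) (V ** real_diag e ** adj V) (V ** Z ** adj U) =
    (\<Sum>i\<in>UNIV. \<Sum>j\<in>UNIV. 2 * Re (of_real (e j - d i) * ((adj V ** U) $ j $ i * cnj (Z $ j $ i)))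
       - ((1 - s) * e j + s * d i) * (cmod (Z $ j $ i))\<^sup>2)"
proof -
  let ?r = "U ** real_diag d ** adj U" and ?s = "V ** real_diag e ** adj V" and ?Y = "V ** Z ** adj U"
  let ?g = "adj V ** U"
  have u: "adj U ** U = mat 1" "U ** adj U = mat 1" "adj V ** V = mat 1" "V ** adj V = mat 1"
    using U V by (auto simp: unitary_mat_adj)
  have 1: "trace (?s ** adj ?Y) = (\<Sum>i\<in>UNIV. \<Sum>j\<in>UNIV. of_real (e j) * (?g $ j $ i * cnj (Z $ j $ i)))"
  proof -
    have "?s ** adj ?Y = V ** (real_diag e ** (?g ** adj Z)) ** adj V"
      by (simp add: adj_mult matrix_mul_assoc)
    then have "trace (?s ** adj ?Y) = trace (real_diag e ** (?g ** adj Z))"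
      by (simp only: trace_unitary_conj[OF V])
    also have "\<dots> = (\<Sum>j\<in>UNIV. \<Sum>i\<in>UNIV. of_real (e j) * (?g $ j $ i * cnj (Z $ j $ i)))"
      by (simp add: trace_def real_diag_mult) (simp add: matrix_matrix_mult_def[of ?g] sum_distrib_left)
    also have "\<dots> = (\<Sum>i\<in>UNIV. \<Sum>j\<in>UNIV. of_real (e j) * (?g $ j $ i * cnj (Z $ j $ i)))"
      by (rule sum.swap)
    finally show ?thesis .
  qed
  have 2: "trace (?r ** adj ?Y) = (\<Sum>i\<in>UNIV. \<Sum>j\<in>UNIV. of_real (d i) * (?g $ j $ i * cnj (Z $ j $ i)))"
  proof -
    have "?r ** adj ?Y = U ** real_diag d ** (adj U ** U) ** adj Z ** adj V"
      by (simp add: adj_mult matrix_mul_assoc)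
    also have "\<dots> = U ** (real_diag d ** (adj Z ** ?g)) ** adj U"
      using u by (simp add: matrix_mul_assoc[symmetric])
    finally have "trace (?r ** adj ?Y) = trace (real_diag d ** (adj Z ** ?g))"
      by (simp only: trace_unitary_conj[OF U])
    also have "\<dots> = (\<Sum>i\<in>UNIV. \<Sum>j\<in>UNIV. of_real (d i) * (?g $ j $ i * cnj (Z $ j $ i)))"
      by (simp add: trace_def real_diag_mult) (simp add: matrix_matrix_mult_def[of "adj Z"] sum_distrib_left mult_ac)
    finally show ?thesis .
  qed
  have 3: "trace (?s ** (?Y ** adj ?Y)) = (\<Sum>i\<in>UNIV. \<Sum>j\<in>UNIV. of_real (e j * (cmod (Z $ j $ i))\<^sup>2))"
  proof -
    have "?s ** (?Y ** adj ?Y) = V ** real_diag e ** (adj V ** V) ** Z ** (adj U ** U) ** adj Z ** adj V"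
      by (simp add: adj_mult matrix_mul_assoc)
    also have "\<dots> = V ** (real_diag e ** (Z ** adj Z)) ** adj V"
      using u by (simp add: matrix_mul_assoc)
    finally have "trace (?s ** (?Y ** adj ?Y)) = trace (real_diag e ** (Z ** adj Z))"
      by (simp only: trace_unitary_conj[OF V])
    also have "\<dots> = (\<Sum>j\<in>UNIV. \<Sum>i\<in>UNIV. of_real (e j * (cmod (Z $ j $ i))\<^sup>2))"
      by (simp add: trace_def real_diag_mult gram_nth sum_distrib_left of_real_cmod_square)
    also have "\<dots> = (\<Sum>i\<in>UNIV. \<Sum>j\<in>UNIV. of_real (e j * (cmod (Z $ j $ i))\<^sup>2))"
      by (rule sum.swap)
    finally show ?thesis .
  qed
  have 4: "trace (?r ** (adj ?Y ** ?Y)) = (\<Sum>i\<in>UNIV. \<Sum>j\<in>UNIV. of_real (d i * (cmod (Z $ j $ i))\<^sup>2))"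
  proof -
    have "?r ** (adj ?Y ** ?Y) = U ** real_diag d ** (adj U ** U) ** adj Z ** (adj V ** V) ** Z ** adj U"
      by (simp add: adj_mult matrix_mul_assoc)
    also have "\<dots> = U ** (real_diag d ** (adj Z ** Z)) ** adj U"
      using u by (simp add: matrix_mul_assoc)
    finally have "trace (?r ** (adj ?Y ** ?Y)) = trace (real_diag d ** (adj Z ** Z))"
      by (simp only: trace_unitary_conj[OF U])
    also have "\<dots> = (\<Sum>i\<in>UNIV. \<Sum>j\<in>UNIV. of_real (d i * (cmod (Z $ j $ i))\<^sup>2))"
      by (simp add: trace_def real_diag_mult adj_gram_nth sum_distrib_left of_real_cmod_square mult_ac)
    finally show ?thesis .
  qed
  have "(?s - ?r) ** adj ?Y = ?s ** adj ?Y - ?r ** adj ?Y"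
    by (simp add: vec_eq_iff matrix_matrix_mult_def left_diff_distrib sum_subtractf)
  then have "variational_form s ?r ?s ?Y = 2 * (Re (trace (?s ** adj ?Y)) - Re (trace (?r ** adj ?Y)))
     - (1 - s) * Re (trace (?s ** (?Y ** adj ?Y))) - s * Re (trace (?r ** (adj ?Y ** ?Y)))"
    by (simp only: variational_form_def trace_sub minus_complex.sel)
  also have "\<dots> = (\<Sum>i\<in>UNIV. \<Sum>j\<in>UNIV. 2 * Re (of_real (e j - d i) * (?g $ j $ i * cnj (Z $ j $ i)))
       - ((1 - s) * e j + s * d i) * (cmod (Z $ j $ i))\<^sup>2)"
    unfolding 1 2 3 4 Re_sum Re_complex_of_real
    by (simp only: sum_distrib_left sum_subtractf[symmetric])
      (intro sum.cong refl, simp add: algebra_simps)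
  finally show ?thesis .
qed

text \<open>For \<open>t > 0\<close> the gap is at least
  \<open>(\<bar>c\<bar> * cmod x - t * cmod z)\<^sup>2 / t\<close>. For \<open>t = 0\<close> also
  \<open>c = 0\<close>, and both sides are 0 since division by zero gives 0.\<close>

lemma complete_square_bound:
  fixes z x :: complex and t c :: real
  assumes "0 \<le> t" "t = 0 \<Longrightarrow> c = 0"
  shows "2 * Re (of_real c * (x * cnj z)) - t * (cmod z)\<^sup>2 \<le> (cmod x)\<^sup>2 * (c\<^sup>2 / t)"
proof (cases "t = 0")
  case False
  then have t: "t > 0" using assms by simp
  have "Re (of_real c * (x * cnj z)) \<le> \<bar>c\<bar> * (cmod x * cmod z)"
    using complex_Re_le_cmod[of "of_real c * (x * cnj z)"] by (simp add: norm_mult)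
  moreover have "2 * (\<bar>c\<bar> * (cmod x * cmod z)) - t * (cmod z)\<^sup>2 \<le> (cmod x)\<^sup>2 * (c\<^sup>2 / t)"
  proof -
    have "0 \<le> (\<bar>c\<bar> * cmod x - t * cmod z)\<^sup>2 / t" using t by simp
    also have "\<dots> = (cmod x)\<^sup>2 * (c\<^sup>2 / t) - (2 * (\<bar>c\<bar> * (cmod x * cmod z)) - t * (cmod z)\<^sup>2)"
      using t by (simp add: power2_diff power_mult_distrib field_simps power2_eq_square)
    finally show ?thesis by simp
  qed
  ultimately show ?thesis by simp
qed (use assms in simp)

lemma denominator_pos:
  fixes s d e :: real
  assumes "0 < s" "s < 1" "0 \<le> d" "0 \<le> e"
  shows "0 \<le> (1 - s) * e + s * d" "(1 - s) * e + s * d = 0 \<Longrightarrow> e = 0 \<and> d = 0"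
  using assms by (auto simp: add_nonneg_eq_0_iff)

lemma variational_form_le_overlap_form:
  assumes U: "unitary_mat U" and V: "unitary_mat V" and s: "0 < s" "s < 1"
    and d: "\<forall>i. 0 \<le> d i" and e: "\<forall>j. 0 \<le> e j"
  shows "variational_form s (U ** real_diag d ** adj U) (V ** real_diag e ** adj V) Y
    \<le> overlap_form s (adj V ** U) d e"
proof -
  \<comment> \<open>Written in the two eigenbases, an arbitrary \<open>Y\<close> has independent
    entries, and each of them can be bounded by itself.\<close>
  have "Y = (V ** adj V) ** Y ** (U ** adj U)" using U V by (simp add: unitary_mat_adj)
  then have Y: "Y = V ** (adj V ** Y ** U) ** adj U" by (simp add: matrix_mul_assoc)
  show ?thesis
    apply (subst Y)
    unfolding variational_form_eig[OF U V] overlap_form_def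
  proof (intro sum_mono)
    fix i j
    have "(d i - e j)\<^sup>2 = (e j - d i)\<^sup>2" by (rule power2_commute)
    then show "2 * Re (of_real (e j - d i) * ((adj V ** U) $ j $ i * cnj ((adj V ** Y ** U) $ j $ i)))
        - ((1 - s) * e j + s * d i) * (cmod ((adj V ** Y ** U) $ j $ i))\<^sup>2
      \<le> (cmod ((adj V ** U) $ j $ i))\<^sup>2 * ((d i - e j)\<^sup>2 / ((1 - s) * e j + s * d i))"
      by (simp only:) (intro complete_square_bound denominator_pos(1)[OF s],
        use denominator_pos(2)[OF s, of "d i" "e j"] d e in auto)
  qed
qed

lemma overlap_form_attained:
  assumes U: "unitary_mat U" and V: "unitary_mat V" and s: "0 < s" "s < 1"
    and d: "\<forall>i. 0 \<le> d i" and e: "\<forall>j. 0 \<le> e j"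
  shows "\<exists>Y. variational_form s (U ** real_diag d ** adj U) (V ** real_diag e ** adj V) Y
    = overlap_form s (adj V ** U) d e"
proof -
  let ?g = "adj V ** U"
  define t where "t i j = (1 - s) * e j + s * d i" for i j
  \<comment> \<open>Entrywise maximiser from completing the square. Where \<open>t i j = 0\<close>
    the entry defaults to 0, which is harmless because both eigenvalues vanish there.\<close>
  define Z :: "'a operator" where "Z = (\<chi> j i. of_real ((e j - d i) / t i j) * ?g $ j $ i)"
  have "2 * Re (of_real (e j - d i) * (?g $ j $ i * cnj (Z $ j $ i))) - t i j * (cmod (Z $ j $ i))\<^sup>2
     = (cmod (?g $ j $ i))\<^sup>2 * ((d i - e j)\<^sup>2 / t i j)" for i j
  proof (cases "t i j = 0")
    case True
    then have "e j = 0 \<and> d i = 0"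
      unfolding t_def by (intro denominator_pos(2)[OF s]) (use d e in auto)
    then show ?thesis by (simp add: t_def)
  next
    case False
    have "Re (of_real (e j - d i) * (?g $ j $ i * cnj (Z $ j $ i))) = Re
        (of_real ((e j - d i) * ((e j - d i) / t i j) * (cmod (?g $ j $ i))\<^sup>2))"
      by (rule arg_cong[where f = Re]) (simp add: Z_def of_real_cmod_square mult_ac)
    then have "Re (of_real (e j - d i) * (?g $ j $ i * cnj (Z $ j $ i))) =
        (e j - d i) * ((e j - d i) / t i j) * (cmod (?g $ j $ i))\<^sup>2"
      by (simp only: Re_complex_of_real)
    moreover have "(cmod (Z $ j $ i))\<^sup>2 = ((e j - d i) / t i j)\<^sup>2 * (cmod (?g $ j $ i))\<^sup>2"
      unfolding Z_def by (simp add: norm_mult norm_divide power_mult_distrib power_divide flip: of_real_diff)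
    ultimately show ?thesis using False
      by (simp only:) (simp add: power2_eq_square field_simps)
  qed
  then have "variational_form s (U ** real_diag d ** adj U) (V ** real_diag e ** adj V) (V ** Z ** adj U)
    = overlap_form s ?g d e"
    by (simp only: variational_form_eig[OF U V] overlap_form_def t_def)
  then show ?thesis by blast
qed

text \<open>The scalar formula is summed over pairs of eigenvalues with the overlap weights. As
  these are doubly stochastic, the linear terms add up to the two traces; \<open>ln 2\<close>
  converts from base 2.\<close>

lemma has_integral_rel_entropy:
  assumes U: "unitary_mat U" and V: "unitary_mat V"
    and d: "\<forall>i. 0 \<le> d i" and e: "\<forall>j. 0 \<le> e j"
    and le: "psd (V ** real_diag e ** adj V - U ** real_diag d ** adj U)"
  shows "((\<lambda>s. (1 - s) * overlap_form s (adj V ** U) d e) has_integral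
    (ln 2 * rel_entropy (U ** real_diag d ** adj U) (V ** real_diag e ** adj V)
      - Re (trace (U ** real_diag d ** adj U)) + Re (trace (V ** real_diag e ** adj V)))) {0..1}"
proof -
  define w where "w i j = (cmod ((adj V ** U) $ j $ i))\<^sup>2" for i j
  have w: "(\<Sum>j\<in>UNIV. w i j) = 1" "(\<Sum>i\<in>UNIV. w i j) = 1" for i j
    by (simp_all add: w_def unitary_sum_norm unitary_mat_adj_mult U V)
  \<comment> \<open>The scalar formula fails if only the second eigenvalue is 0, but such pairs have
    weight 0 by the operator order.\<close>
  have wd: "w i j = 0 \<or> (e j = 0 \<longrightarrow> d i = 0)" for i j
    using eig_support[where U=U and V=V and d=d and e=e, OF U V _ _ le] d by (auto simp: w_def)
  let ?v = "\<lambda>i j. d i * (ln (d i) - ln (e j)) - d i + e j"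
  have "((\<lambda>s. \<Sum>i\<in>UNIV. \<Sum>j\<in>UNIV. w i j * ((1 - s) * ((d i - e j)\<^sup>2 / ((1 - s) * e j + s * d i)))) has_integral
      (\<Sum>i\<in>UNIV. \<Sum>j\<in>UNIV. w i j * ?v i j)) {0..1}"
  proof (intro has_integral_sum finite)
    fix i j
    show "((\<lambda>s. w i j * ((1 - s) * ((d i - e j)\<^sup>2 / ((1 - s) * e j + s * d i)))) has_integral (w i j * ?v i j)) {0..1}"
    proof (cases "w i j = 0")
      case False
      then show ?thesis using wd[of i j] d e
        by (intro has_integral_mult_right has_integral_relative_entropy_kernel) auto
    qed simp
  qed
  moreover have "(\<Sum>i\<in>UNIV. \<Sum>j\<in>UNIV. w i j * ((1 - s) * ((d i - e j)\<^sup>2 / ((1 - s) * e j + s * d i))))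
      = (1 - s) * overlap_form s (adj V ** U) d e" for s
    by (simp add: overlap_form_def w_def sum_distrib_left mult_ac)
  moreover have "(\<Sum>i\<in>UNIV. \<Sum>j\<in>UNIV. w i j * ?v i j) =
     ln 2 * rel_entropy (U ** real_diag d ** adj U) (V ** real_diag e ** adj V)
      - Re (trace (U ** real_diag d ** adj U)) + Re (trace (V ** real_diag e ** adj V))"
  proof -
    have "(\<Sum>i\<in>UNIV. \<Sum>j\<in>UNIV. w i j * ?v i j) =
       (\<Sum>i\<in>UNIV. \<Sum>j\<in>UNIV. w i j * (d i * (ln (d i) - ln (e j)))) -
       (\<Sum>i\<in>UNIV. (\<Sum>j\<in>UNIV. w i j) * d i) + (\<Sum>i\<in>UNIV. \<Sum>j\<in>UNIV. w i j * e j)"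
      by (simp add: algebra_simps sum.distrib sum_subtractf sum_distrib_left sum_distrib_right)
    also have "(\<Sum>i\<in>UNIV. \<Sum>j\<in>UNIV. w i j * e j) = (\<Sum>j\<in>UNIV. (\<Sum>i\<in>UNIV. w i j) * e j)"
      by (subst sum.swap) (simp add: sum_distrib_right)
    also have "(\<Sum>i\<in>UNIV. \<Sum>j\<in>UNIV. w i j * (d i * (ln (d i) - ln (e j)))) =
       ln 2 * rel_entropy (U ** real_diag d ** adj U) (V ** real_diag e ** adj V)"
      unfolding rel_entropy_eig[OF U V] w_def sum_distrib_left
      by (intro sum.cong refl) (simp add: log_def field_simps)
    finally show ?thesis
      by (simp add: w trace_unitary_conj U V trace_real_diag)
  qed
  ultimately show ?thesis by simp
qed

section \<open>Partial trace and its dual embedding\<close>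

lemma sum_UNIV_prod: "(\<Sum>p\<in>UNIV. f p) = (\<Sum>i\<in>UNIV. \<Sum>j\<in>UNIV. f (i, j))"
  by (simp add: sum.cartesian_product flip: UNIV_Times_UNIV)

lemma tensor_mat_1_mult: "tensor_op A (mat 1) ** tensor_op B (mat 1) = tensor_op (A ** B) (mat 1 :: 'b::finite operator)"
proof -
  have "(\<Sum>j\<in>UNIV. x * mat 1 $ b $ j * (y * mat 1 $ j $ d)) = x * y * mat 1 $ b $ d"
    for x y :: complex and b d :: 'b
  proof -
    have "(\<Sum>j\<in>UNIV. x * mat 1 $ b $ j * (y * mat 1 $ j $ d)) =
        (\<Sum>j\<in>UNIV. if j = b then x * y * mat 1 $ b $ d else 0)"
      by (intro sum.cong refl) (auto simp: mat_def)
    then show ?thesis by simp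
  qed
  then show ?thesis
    by (simp add: vec_eq_iff tensor_op_def matrix_matrix_mult_def sum_UNIV_prod sum_distrib_right)
qed

lemma adj_tensor_mat_1: "adj (tensor_op A (mat 1)) = tensor_op (adj A) (mat 1)"
  by (auto simp: vec_eq_iff tensor_op_def mat_def)

lemma trace_mult_tensor_mat_1: "trace (M ** tensor_op A (mat 1)) = trace (ptrace_snd M ** A)"
proof -
  have "trace (M ** tensor_op A (mat 1)) =
     (\<Sum>i\<in>UNIV. \<Sum>j\<in>UNIV. \<Sum>k\<in>UNIV. \<Sum>l\<in>UNIV. M $ (i, j) $ (k, l) * (A $ k $ i * mat 1 $ l $ j))"
    by (simp add: trace_def matrix_matrix_mult_def tensor_op_def sum_UNIV_prod)
  also have "\<dots> = (\<Sum>i\<in>UNIV. \<Sum>j\<in>UNIV. \<Sum>k\<in>UNIV. M $ (i, j) $ (k, j) * A $ k $ i)"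
  proof (intro sum.cong refl)
    fix i j k
    have "(\<Sum>l\<in>UNIV. M $ (i, j) $ (k, l) * (A $ k $ i * mat 1 $ l $ j)) =
        (\<Sum>l\<in>UNIV. if l = j then M $ (i, j) $ (k, j) * A $ k $ i else 0)"
      by (intro sum.cong refl) (auto simp: mat_def)
    then show "(\<Sum>l\<in>UNIV. M $ (i, j) $ (k, l) * (A $ k $ i * mat 1 $ l $ j)) =
        M $ (i, j) $ (k, j) * A $ k $ i" by simp
  qed
  also have "\<dots> = (\<Sum>i\<in>UNIV. \<Sum>k\<in>UNIV. \<Sum>j\<in>UNIV. M $ (i, j) $ (k, j) * A $ k $ i)"
    by (intro sum.cong refl sum.swap)
  also have "\<dots> = trace (ptrace_snd M ** A)"
    by (simp add: trace_def matrix_matrix_mult_def ptrace_snd_def sum_distrib_right)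
  finally show ?thesis .
qed

lemma trace_ptrace_snd: "trace (ptrace_snd M) = trace M"
  by (simp add: trace_def ptrace_snd_def sum_UNIV_prod)

lemma ptrace_snd_diff: "ptrace_snd (M - N) = ptrace_snd M - ptrace_snd N"
  by (simp add: vec_eq_iff ptrace_snd_def sum_subtractf)

text \<open>The partial trace of a Gram matrix is again a Gram matrix: the traced index moves from
  the rows of the factor to its columns.\<close>

lemma psd_ptrace_snd:
  fixes M :: "('m::finite \<times> 'n::finite) operator"
  assumes "psd M"
  shows "psd (ptrace_snd M)"
proof -
  obtain G :: "('m \<times> 'n) operator" where G: "M = G ** adj G"
    by (rule psd_eq_gram[OF assms])
  let ?L = "(\<chi> i p. G $ (i, fst p) $ snd p) :: complex ^ ('n \<times> ('m \<times> 'n)) ^ 'm"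
  have "ptrace_snd M = ?L ** adj ?L"
    unfolding G vec_eq_iff gram_nth ptrace_snd_def by (simp add: gram_nth sum_UNIV_prod)
  then show ?thesis by (simp add: psd_gram)
qed

text \<open>Tensoring with the identity is multiplicative, respects adjoints and is dual to the
  partial trace.\<close>

lemma variational_form_tensor:
  "variational_form s M N (tensor_op Y (mat 1)) = variational_form s (ptrace_snd M) (ptrace_snd N) Y"
  by (simp add: variational_form_def adj_tensor_mat_1 tensor_mat_1_mult trace_mult_tensor_mat_1 ptrace_snd_diff)

text \<open>For each \<open>s\<close> the optimal \<open>Y\<close> for the partial traces, tensored
  with the identity, is a competitor for the full operators. Integrating over \<open>s\<close>
  compares the relative entropies, since the trace terms agree on both sides.\<close>

theorem rel_entropy_ptrace_mono:
  fixes \<rho> \<sigma> :: "('m::finite \<times> 'n::finite) operator"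
  assumes r: "psd \<rho>" and s: "psd \<sigma>" and le: "psd (\<sigma> - \<rho>)"
  shows "rel_entropy (ptrace_snd \<rho>) (ptrace_snd \<sigma>) \<le> rel_entropy \<rho> \<sigma>"
proof -
  obtain U d where U: "unitary_mat U" "\<rho> = U ** real_diag d ** adj U" "\<forall>i. 0 \<le> d i"
    by (rule psd_diagonalisation[OF r])
  obtain V e where V: "unitary_mat V" "\<sigma> = V ** real_diag e ** adj V" "\<forall>i. 0 \<le> e i"
    by (rule psd_diagonalisation[OF s])
  obtain U' d' where U': "unitary_mat U'" "ptrace_snd \<rho> = U' ** real_diag d' ** adj U'" "\<forall>i. 0 \<le> d' i"
    by (rule psd_diagonalisation[OF psd_ptrace_snd[OF r]])
  obtain V' e' where V': "unitary_mat V'" "ptrace_snd \<sigma> = V' ** real_diag e' ** adj V'" "\<forall>i. 0 \<le> e' i"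
    by (rule psd_diagonalisation[OF psd_ptrace_snd[OF s]])
  have le': "psd (ptrace_snd \<sigma> - ptrace_snd \<rho>)"
    using psd_ptrace_snd[OF le] by (simp add: ptrace_snd_diff)
  have mono: "overlap_form s (adj V' ** U') d' e' \<le> overlap_form s (adj V ** U) d e" if s01: "0 < s" "s < 1" for s
  proof -
    obtain Y where "overlap_form s (adj V' ** U') d' e' = variational_form s (ptrace_snd \<rho>) (ptrace_snd \<sigma>) Y"
      using overlap_form_attained[OF U'(1) V'(1) s01 U'(3) V'(3)] U'(2) V'(2) by metis
    also have "\<dots> = variational_form s \<rho> \<sigma> (tensor_op Y (mat 1))"
      by (simp only: variational_form_tensor)
    also have "\<dots> \<le> overlap_form s (adj V ** U) d e"
      using variational_form_le_overlap_form[OF U(1) V(1) s01 U(3) V(3)] U(2) V(2) by simp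
    finally show ?thesis .
  qed
  have i: "((\<lambda>s. (1 - s) * overlap_form s (adj V ** U) d e) has_integral
      (ln 2 * rel_entropy \<rho> \<sigma> - Re (trace \<rho>) + Re (trace \<sigma>))) {0..1}"
    by (rule has_integral_rel_entropy[OF U(1) V(1) U(3) V(3), folded U(2) V(2), OF le])
  have i': "((\<lambda>s. (1 - s) * overlap_form s (adj V' ** U') d' e') has_integral
      (ln 2 * rel_entropy (ptrace_snd \<rho>) (ptrace_snd \<sigma>) - Re (trace \<rho>) + Re (trace \<sigma>))) {0..1}"
    using has_integral_rel_entropy[OF U'(1) V'(1) U'(3) V'(3), folded U'(2) V'(2), OF le']
    by (simp only: trace_ptrace_snd)
  have "ln 2 * rel_entropy (ptrace_snd \<rho>) (ptrace_snd \<sigma>) - Re (trace \<rho>) + Re (trace \<sigma>)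
     \<le> ln 2 * rel_entropy \<rho> \<sigma> - Re (trace \<rho>) + Re (trace \<sigma>)"
  proof (rule has_integral_le)
    \<comment> \<open>At the endpoints a denominator may vanish although one eigenvalue is nonzero.
      The comparison is therefore made on the open interval, which leaves the integrals
      unchanged.\<close>
    show "((\<lambda>s. if 0 < s \<and> s < 1 then (1 - s) * overlap_form s (adj V' ** U') d' e' else 0) has_integral
      (ln 2 * rel_entropy (ptrace_snd \<rho>) (ptrace_snd \<sigma>) - Re (trace \<rho>) + Re (trace \<sigma>))) {0..1}"
      by (rule has_integral_spike[of "{0, 1}", rotated 2, OF i']) auto
    show "((\<lambda>s. if 0 < s \<and> s < 1 then (1 - s) * overlap_form s (adj V ** U) d e else 0) has_integral
      (ln 2 * rel_entropy \<rho> \<sigma> - Re (trace \<rho>) + Re (trace \<sigma>))) {0..1}"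
      by (rule has_integral_spike[of "{0, 1}", rotated 2, OF i]) auto
  qed (use mono in \<open>auto intro!: mult_left_mono\<close>)
  then show ?thesis by simp
qed

section \<open>Unnormalised conditional states\<close>

lemma psd_0: "psd 0"
  using psd_gram[of 0] by simp

lemma psd_add: "psd M \<Longrightarrow> psd N \<Longrightarrow> psd (M + N)"
  by (simp add: psd_def adjoint_mat_def vec_eq_iff matrix_vector_mult_add_rdistrib cinner_add_right)

lemma psd_sum: "(\<And>k. k \<in> K \<Longrightarrow> psd (M k)) \<Longrightarrow> psd (\<Sum>k\<in>K. M k)"
  by (induction K rule: infinite_finite_induct) (auto simp: psd_0 psd_add)

lemma psd_sum_diff:
  assumes "finite K" "k \<in> K" "\<And>k. k \<in> K \<Longrightarrow> psd (M k)"
  shows "psd ((\<Sum>k\<in>K. M k) - M k)"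
  using psd_sum[of "K - {k}" M] assms by (simp add: sum.remove[of K k])

lemma trace_sum: "trace (\<Sum>k\<in>K. M k) = (\<Sum>k\<in>K. trace (M k))"
  by (simp add: trace_def sum.swap[of _ _ K])

lemma sum_matrix_mult: "(\<Sum>k\<in>K. M k) ** N = (\<Sum>k\<in>K. M k ** N)"
  by (simp add: vec_eq_iff matrix_matrix_mult_def sum_distrib_right sum.swap[of _ _ K])

text \<open>The cross terms of all \<open>M k\<close> with the logarithm of the sum combine to the
  entropy of the sum. For total trace 1 this is the Holevo quantity of the ensemble minus the
  Shannon entropy of its weights.\<close>

lemma sum_rel_entropy:
  "(\<Sum>k\<in>K. rel_entropy (M k) (\<Sum>k\<in>K. M k)) = vn_entropy (\<Sum>k\<in>K. M k) - (\<Sum>k\<in>K. vn_entropy (M k))"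
  unfolding rel_entropy_def vn_entropy_def[of "\<Sum>k\<in>K. M k"]
  by (simp add: sum_subtractf sum_negf sum_matrix_mult trace_sum)

section \<open>Traces and normalisation of positive operators\<close>

lemma Re_trace_eig:
  "unitary_mat U \<Longrightarrow> Re (trace (U ** real_diag d ** adj U)) = (\<Sum>i\<in>UNIV. d i)"
  by (simp add: trace_unitary_conj trace_real_diag)

lemma psd_trace_nonneg:
  assumes "psd M"
  shows "0 \<le> Re (trace M)"
proof -
  obtain U d where U: "unitary_mat U" "M = U ** real_diag d ** adj U" "\<forall>i. 0 \<le> d i"
    by (rule psd_diagonalisation[OF assms])
  then show ?thesis by (simp add: Re_trace_eig sum_nonneg)
qed

lemma psd_trace_0:
  assumes "psd M" "Re (trace M) = 0"
  shows "M = 0"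
proof -
  obtain U d where U: "unitary_mat U" "M = U ** real_diag d ** adj U" "\<forall>i. 0 \<le> d i"
    by (rule psd_diagonalisation[OF assms(1)])
  then have "(\<Sum>i\<in>UNIV. d i) = 0" using assms(2) by (simp add: Re_trace_eig)
  then have "d i = 0" for i using U(3) by (simp add: sum_nonneg_eq_0_iff)
  then have "real_diag d = 0" by (simp add: real_diag_def vec_eq_iff)
  then show ?thesis by (simp add: U(2))
qed

lemma vn_entropy_0: "vn_entropy 0 = 0"
  by (simp add: vn_entropy_def trace_def)

text \<open>
  For \<open>t = Tr M > 0\<close> this is \<open>t S(M / t)\<close>, see \<open>scaled_entropy_eq\<close>; it makes the outcome
  probabilities disappear from the information gain.
\<close>

definition scaled_entropy :: "'n::finite operator \<Rightarrow> real" where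
  "scaled_entropy M = vn_entropy M + Re (trace M) * log 2 (Re (trace M))"

lemma scaled_entropy_eq:
  assumes "psd M" "Re (trace M) \<noteq> 0"
  shows "Re (trace M) * vn_entropy ((1 / Re (trace M)) *\<^sub>R M) = scaled_entropy M"
proof -
  define t where "t = Re (trace M)"
  have t: "t > 0" using assms psd_trace_nonneg by (force simp: t_def)
  obtain U d where U: "unitary_mat U" "M = U ** real_diag d ** adj U" "\<forall>i. 0 \<le> d i"
    by (rule psd_diagonalisation[OF assms(1)])
  have s: "(\<Sum>i\<in>UNIV. d i) = t" using U by (simp add: t_def Re_trace_eig)
  have "(1 / t) *\<^sub>R M = U ** real_diag (\<lambda>i. d i / t) ** adj U"
    unfolding U(2) vec_eq_iff vector_scaleR_component matrix_matrix_mult_def[of "U ** _"]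
    by (simp add: mult_real_diag scaleR_sum_right) (simp add: scaleR_conv_of_real mult_ac)
  then have "t * vn_entropy ((1 / t) *\<^sub>R M) = - (\<Sum>i\<in>UNIV. d i * log 2 (d i / t))"
    using t by (simp add: vn_entropy_eig[OF U(1)] sum_distrib_left)
  also have "(\<Sum>i\<in>UNIV. d i * log 2 (d i / t)) = (\<Sum>i\<in>UNIV. d i * log 2 (d i) - d i * log 2 t)"
  proof (intro sum.cong refl)
    fix i
    show "d i * log 2 (d i / t) = d i * log 2 (d i) - d i * log 2 t"
      using t U(3) by (cases "d i = 0") (auto simp: log_divide less_le right_diff_distrib)
  qed
  also have "\<dots> = - vn_entropy M - t * log 2 t"
    by (simp add: sum_subtractf U(2) vn_entropy_eig[OF U(1)] flip: sum_distrib_right s)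
  finally show ?thesis by (simp add: scaled_entropy_def t_def)
qed

lemma scaled_entropy_nonneg:
  assumes "psd M"
  shows "0 \<le> scaled_entropy M"
proof -
  obtain U d where U: "unitary_mat U" "M = U ** real_diag d ** adj U" "\<forall>i. 0 \<le> d i"
    by (rule psd_diagonalisation[OF assms])
  define t where "t = (\<Sum>i\<in>UNIV. d i)"
  have "scaled_entropy M = (\<Sum>i\<in>UNIV. d i * (log 2 t - log 2 (d i)))"
    by (simp add: scaled_entropy_def U(2) vn_entropy_eig[OF U(1)] Re_trace_eig[OF U(1)] t_def
        right_diff_distrib sum_subtractf sum_distrib_right)
  also have "\<dots> \<ge> 0"
  proof (intro sum_nonneg)
    fix i
    have "d i \<le> t" unfolding t_def using U(3) by (intro member_le_sum) auto
    then have "log 2 (d i) \<le> log 2 t" if "d i \<noteq> 0"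
    proof -
      have "0 < d i" using U(3) that by (simp add: less_le)
      then show ?thesis using \<open>d i \<le> t\<close> by simp
    qed
    then show "0 \<le> d i * (log 2 t - log 2 (d i))"
      using U(3) by (cases "d i = 0") auto
  qed
  finally show ?thesis .
qed

text \<open>The log-sum inequality for the joint weights of the two spectra, or monotonicity under
  the full trace. It follows termwise from \<open>ln x \<le> x - 1\<close>.\<close>

lemma rel_entropy_trace_bound:
  assumes r: "psd \<rho>" and s: "psd \<sigma>" and le: "psd (\<sigma> - \<rho>)"
  shows "Re (trace \<rho>) * (log 2 (Re (trace \<rho>)) - log 2 (Re (trace \<sigma>))) \<le> rel_entropy \<rho> \<sigma>"
proof (cases "Re (trace \<rho>) = 0")
  case True
  then have "\<rho> = 0" using psd_trace_0 r by blast
  then show ?thesis by (simp add: rel_entropy_def vn_entropy_0 trace_def)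
next
  case False
  define p where "p = Re (trace \<rho>)"
  define q where "q = Re (trace \<sigma>)"
  have p: "p > 0" using False psd_trace_nonneg[OF r] by (simp add: p_def)
  have q: "q > 0" using p psd_trace_nonneg[OF le] by (simp add: p_def q_def trace_sub)
  \<comment> \<open>Rescaling by the ratio of the traces makes the linear terms \<open>p\<close> and
    \<open>c * q\<close> cancel after summation.\<close>
  define c where "c = p / q"
  have c: "c > 0" using p q by (simp add: c_def)
  obtain U d where U: "unitary_mat U" "\<rho> = U ** real_diag d ** adj U" "\<forall>i. 0 \<le> d i"
    by (rule psd_diagonalisation[OF r])
  obtain V e where V: "unitary_mat V" "\<sigma> = V ** real_diag e ** adj V" "\<forall>i. 0 \<le> e i"
    by (rule psd_diagonalisation[OF s])
  define w where "w i j = (cmod ((adj V ** U) $ j $ i))\<^sup>2" for i j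
  have w: "(\<Sum>j\<in>UNIV. w i j) = 1" "(\<Sum>i\<in>UNIV. w i j) = 1" for i j
    by (simp_all add: w_def unitary_sum_norm unitary_mat_adj_mult U V)
  have wd: "w i j = 0 \<or> (e j = 0 \<longrightarrow> d i = 0)" for i j
    using eig_support[where U=U and V=V and d=d and e=e, OF U(1) V(1)] le U V by (auto simp: w_def)
  have pe: "p = (\<Sum>i\<in>UNIV. d i)" "q = (\<Sum>j\<in>UNIV. e j)"
    by (simp_all add: p_def q_def U V Re_trace_eig)
  have "w i j * (d i * (ln (d i) - ln (e j))) \<ge> w i j * d i * (ln c + 1) - c * (w i j * e j)" for i j
  proof -
    have "d i * (ln (d i) - ln (e j)) \<ge> d i * (ln c + 1) - c * e j" if "e j = 0 \<longrightarrow> d i = 0"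
    proof (cases "d i = 0")
      case True
      then show ?thesis using c V(3) by simp
    next
      case False
      then have pos: "d i > 0" "e j > 0" using U(3) V(3) that by (auto simp: less_le)
      then have "ln (c * e j / d i) \<le> c * e j / d i - 1"
        using c by (intro ln_le_minus_one) auto
      then have "ln c + ln (e j) - ln (d i) + 1 \<le> c * e j / d i"
        using pos c by (simp add: ln_div ln_mult)
      then have "d i * (ln c + ln (e j) - ln (d i) + 1) \<le> d i * (c * e j / d i)"
        using pos by (intro mult_left_mono) auto
      then show ?thesis using pos by (simp add: algebra_simps)
    qed
    moreover have "w i j \<ge> 0" by (simp add: w_def)
    ultimately have "w i j * (d i * (ln c + 1) - c * e j) \<le> w i j * (d i * (ln (d i) - ln (e j)))"
      using wd[of i j] by (cases "w i j = 0") (auto intro: mult_left_mono)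
    moreover have "w i j * (d i * (ln c + 1) - c * e j) = w i j * d i * (ln c + 1) - c * (w i j * e j)"
      by (simp add: algebra_simps)
    ultimately show ?thesis by simp
  qed
  then have "(\<Sum>i\<in>UNIV. \<Sum>j\<in>UNIV. w i j * d i * (ln c + 1) - c * (w i j * e j))
     \<le> (\<Sum>i\<in>UNIV. \<Sum>j\<in>UNIV. w i j * (d i * (ln (d i) - ln (e j))))"
    by (intro sum_mono)
  also have "(\<Sum>i\<in>UNIV. \<Sum>j\<in>UNIV. w i j * (d i * (ln (d i) - ln (e j)))) = ln 2 * rel_entropy \<rho> \<sigma>"
    unfolding U(2) V(2) rel_entropy_eig[OF U(1) V(1)] w_def sum_distrib_left
    by (intro sum.cong refl) (simp add: log_def field_simps)
  also have "(\<Sum>i\<in>UNIV. \<Sum>j\<in>UNIV. w i j * d i * (ln c + 1) - c * (w i j * e j)) =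
     (\<Sum>i\<in>UNIV. (\<Sum>j\<in>UNIV. w i j) * (d i * (ln c + 1))) - c * (\<Sum>i\<in>UNIV. \<Sum>j\<in>UNIV. w i j * e j)"
    by (simp add: sum_subtractf sum_distrib_left sum_distrib_right mult.assoc)
  also have "(\<Sum>i\<in>UNIV. \<Sum>j\<in>UNIV. w i j * e j) = (\<Sum>j\<in>UNIV. (\<Sum>i\<in>UNIV. w i j) * e j)"
    by (subst sum.swap) (simp add: sum_distrib_right)
  also have "(\<Sum>i\<in>UNIV. (\<Sum>j\<in>UNIV. w i j) * (d i * (ln c + 1))) - c * (\<Sum>j\<in>UNIV. (\<Sum>i\<in>UNIV. w i j) * e j)
     = p * (ln c + 1) - c * q"
    by (simp add: w flip: pe sum_distrib_right)
  also have "\<dots> = p * (ln p - ln q)" using p q by (simp add: c_def ln_div algebra_simps)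
  finally have "p * (ln p - ln q) / ln 2 \<le> rel_entropy \<rho> \<sigma>"
    by (simp add: divide_le_eq mult.commute)
  then show ?thesis by (simp add: log_def p_def q_def flip: diff_divide_distrib)
qed

text \<open>Concavity of the entropy in unnormalised form: the trace bound is applied to each
  \<open>M k\<close> against the sum. Hence refining a measurement cannot increase the average
  conditional entropy.\<close>

lemma scaled_entropy_sum_le:
  assumes K: "finite K" and M: "\<And>k. k \<in> K \<Longrightarrow> psd (M k)"
  shows "(\<Sum>k\<in>K. scaled_entropy (M k)) \<le> scaled_entropy (\<Sum>k\<in>K. M k)"
proof -
  let ?S = "\<Sum>k\<in>K. M k" and ?t = "\<lambda>M. Re (trace M)"
  have "(\<Sum>k\<in>K. ?t (M k) * (log 2 (?t (M k)) - log 2 (?t ?S))) \<le> (\<Sum>k\<in>K. rel_entropy (M k) ?S)"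
    using K M by (intro sum_mono rel_entropy_trace_bound psd_sum_diff psd_sum) auto
  also have "\<dots> = vn_entropy ?S - (\<Sum>k\<in>K. vn_entropy (M k))" by (rule sum_rel_entropy)
  also have "(\<Sum>k\<in>K. ?t (M k) * (log 2 (?t (M k)) - log 2 (?t ?S))) =
      (\<Sum>k\<in>K. ?t (M k) * log 2 (?t (M k))) - ?t ?S * log 2 (?t ?S)"
    by (simp add: right_diff_distrib sum_subtractf trace_sum sum_distrib_right)
  finally show ?thesis by (simp add: scaled_entropy_def sum.distrib)
qed

section \<open>Conditional operators and the information gain\<close>

definition cond_op :: "('x::finite \<times> 'b::finite) operator \<Rightarrow> 'b operator \<Rightarrow> 'x operator" where
  "cond_op \<rho> F = ptrace_snd (tensor_op (mat 1) F ** \<rho>)"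

lemma cond_op_nth:
  "cond_op \<rho> F $ x $ y = (\<Sum>b\<in>UNIV. \<Sum>b'\<in>UNIV. F $ b $ b' * \<rho> $ (x, b') $ (y, b))"
proof -
  have "(\<Sum>i\<in>UNIV. \<Sum>b'\<in>UNIV. mat 1 $ x $ i * F $ b $ b' * \<rho> $ (i, b') $ (y, b)) =
      (\<Sum>i\<in>UNIV. if i = x then \<Sum>b'\<in>UNIV. F $ b $ b' * \<rho> $ (x, b') $ (y, b) else 0)" for b
    by (intro sum.cong refl) (auto simp: mat_def)
  then show ?thesis
    by (simp add: cond_op_def ptrace_snd_def tensor_op_def matrix_matrix_mult_def sum_UNIV_prod)
qed

lemma cond_op_sum: "cond_op \<rho> (\<Sum>k\<in>K. F k) = (\<Sum>k\<in>K. cond_op \<rho> (F k))"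
  by (simp add: vec_eq_iff cond_op_nth sum_distrib_right sum.swap[of _ _ K])

lemma trace_cond_op: "outcome_prob \<rho> F = Re (trace (cond_op \<rho> F))"
  by (simp add: outcome_prob_def cond_op_def trace_ptrace_snd)

text \<open>\<open>V\<close> holds the amplitudes of a purification. Each column of \<open>G\<close>
  acts as a bra on the measured system, and the columns of \<open>L\<close> pair that column index
  with the purifying one.\<close>

lemma cond_op_gram:
  fixes V :: "complex ^ 'r::finite ^ ('x::finite \<times> 'b::finite)" and G :: "complex ^ 'k::finite ^ 'b"
  defines "L \<equiv> (\<chi> x q. \<Sum>b\<in>UNIV. cnj (G $ b $ fst q) * V $ (x, b) $ snd q)"
  shows "cond_op (V ** adj V) (G ** adj G) = L ** adj L"
proof -
  have "cond_op (V ** adj V) (G ** adj G) $ x $ y = (L ** adj L) $ x $ y" for x y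
  proof -
    have "cond_op (V ** adj V) (G ** adj G) $ x $ y = (\<Sum>b\<in>UNIV. \<Sum>b'\<in>UNIV. \<Sum>k\<in>UNIV. \<Sum>r\<in>UNIV.
        G $ b $ k * cnj (G $ b' $ k) * (V $ (x, b') $ r * cnj (V $ (y, b) $ r)))"
      by (simp add: cond_op_nth gram_nth sum_product)
    also have "\<dots> = (\<Sum>(b, b', k, r)\<in>UNIV.
        G $ b $ k * cnj (G $ b' $ k) * (V $ (x, b') $ r * cnj (V $ (y, b) $ r)))"
      by (simp add: sum_UNIV_prod)
    also have "\<dots> = (\<Sum>(k, r, b', b)\<in>UNIV.
        cnj (G $ b' $ k) * V $ (x, b') $ r * (G $ b $ k * cnj (V $ (y, b) $ r)))"
      by (rule sum.reindex_bij_witness[of _ "\<lambda>(k, r, b', b). (b, b', k, r)" "\<lambda>(b, b', k, r). (k, r, b', b)"])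
        (auto simp: mult_ac)
    also have "\<dots> = (L ** adj L) $ x $ y"
      by (simp add: gram_nth L_def sum_UNIV_prod sum_product)
    finally show ?thesis .
  qed
  then show ?thesis by (simp add: vec_eq_iff)
qed

lemma psd_cond_op:
  assumes "psd \<rho>" "psd F"
  shows "psd (cond_op \<rho> F)"
proof -
  obtain V :: "('a \<times> 'b) operator" where "\<rho> = V ** adj V" by (rule psd_eq_gram[OF assms(1)])
  moreover obtain G :: "'b operator" where "F = G ** adj G" by (rule psd_eq_gram[OF assms(2)])
  ultimately show ?thesis by (simp only: cond_op_gram psd_gram)
qed

text \<open>Outcomes of probability 0 may be included: their conditional operator is positive with
  trace 0, hence 0, and has scaled entropy 0.\<close>

lemma info_gain_eq:
  assumes "psd \<rho>" "\<And>i. i < n \<Longrightarrow> psd (E i)"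
  shows "info_gain \<rho> n E = vn_entropy (ptrace_snd \<rho>) - (\<Sum>i<n. scaled_entropy (cond_op \<rho> (E i)))"
proof -
  let ?M = "\<lambda>i. cond_op \<rho> (E i)"
  have "(\<Sum>i | i < n \<and> outcome_prob \<rho> (E i) \<noteq> 0. outcome_prob \<rho> (E i) * vn_entropy (post_state \<rho> (E i))) =
      (\<Sum>i | i < n \<and> outcome_prob \<rho> (E i) \<noteq> 0. scaled_entropy (?M i))"
  proof (intro sum.cong refl)
    fix i assume "i \<in> {i. i < n \<and> outcome_prob \<rho> (E i) \<noteq> 0}"
    then have "psd (?M i)" "Re (trace (?M i)) \<noteq> 0"
      using assms by (auto intro: psd_cond_op simp: trace_cond_op)
    from scaled_entropy_eq[OF this]
    show "outcome_prob \<rho> (E i) * vn_entropy (post_state \<rho> (E i)) = scaled_entropy (?M i)"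
      by (simp add: post_state_def trace_cond_op flip: cond_op_def)
  qed
  also have "\<dots> = (\<Sum>i<n. scaled_entropy (?M i))"
  proof (intro sum.mono_neutral_left ballI)
    fix i assume "i \<in> {..<n} - {i. i < n \<and> outcome_prob \<rho> (E i) \<noteq> 0}"
    then have "psd (?M i)" "Re (trace (?M i)) = 0"
      using assms by (auto intro: psd_cond_op simp: trace_cond_op)
    then have "?M i = 0" by (rule psd_trace_0)
    then show "scaled_entropy (?M i) = 0" by (simp add: scaled_entropy_def vn_entropy_0 trace_def)
  qed auto
  finally show ?thesis by (simp add: info_gain_def)
qed

text \<open>\<open>Sup\<close> on the reals is an upper bound only for bounded sets. Nonnegativity
  of the scaled entropies bounds every information gain by the entropy of the unmeasured
  system.\<close>

lemma info_gain_le_classical_correlation: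
  assumes "psd \<rho>" "povm n E"
  shows "info_gain \<rho> n E \<le> classical_correlation \<rho>"
  unfolding classical_correlation_def
proof (rule cSup_upper)
  show "bdd_above {info_gain \<rho> n E | n E. povm n E}"
  proof (rule bdd_aboveI)
    fix x assume "x \<in> {info_gain \<rho> n E | n E. povm n E}"
    then obtain n E where x: "x = info_gain \<rho> n E" and E: "povm n E" by blast
    have "0 \<le> (\<Sum>i<n. scaled_entropy (cond_op \<rho> (E i)))"
      using E assms(1) by (intro sum_nonneg scaled_entropy_nonneg psd_cond_op) (auto simp: povm_def)
    then show "x \<le> vn_entropy (ptrace_snd \<rho>)"
      using E assms(1) by (simp add: x info_gain_eq povm_def)
  qed
qed (use assms in auto)

lemma psd_mat_1: "psd (mat 1)"
proof -
  have "adj (mat 1 :: 'a operator) = mat 1" by (auto simp: vec_eq_iff mat_def)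
  then show ?thesis using psd_gram[of "mat 1 :: 'a operator"] by simp
qed

lemma classical_correlation_le:
  assumes "\<And>n E. povm n E \<Longrightarrow> info_gain \<rho> n E \<le> c"
  shows "classical_correlation \<rho> \<le> c"
  unfolding classical_correlation_def
proof (rule cSup_least)
  \<comment> \<open>The trivial measurement shows that the set under \<open>Sup\<close> is
    nonempty.\<close>
  have "povm 1 (\<lambda>_. mat 1)" by (simp add: povm_def psd_mat_1)
  then show "{info_gain \<rho> n E | n E. povm n E} \<noteq> {}" by blast
qed (use assms in blast)

section \<open>Rank-one measurements\<close>

text \<open>The two marginals of a bipartite pure state with amplitudes \<open>X\<close> have the same entropy.\<close>

lemma vn_entropy_complementary:
  "vn_entropy (X ** adj X) = vn_entropy (transpose X ** adj (transpose X))"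
proof -
  have "transpose (X ** adj X) = adj (transpose X) ** transpose X"
    by (simp add: vec_eq_iff transpose_def gram_nth adj_gram_nth mult.commute)
  moreover have "adj (X ** adj X) = X ** adj X" by (simp add: adj_mult)
  ultimately show ?thesis
    by (metis vn_entropy_transpose vn_entropy_gram_swap)
qed

definition ketbra :: "complex ^ 'b::finite \<Rightarrow> 'b operator" where
  "ketbra f = (\<chi> b b'. f $ b * cnj (f $ b'))"

text \<open>The index type \<open>unit\<close> presents the rank-one operator as the Gram matrix of
  a single column, so that \<open>cond_op_gram\<close> applies.\<close>

lemma ketbra_gram: "ketbra f = (\<chi> b (k::unit). f $ b) ** adj (\<chi> b k. f $ b)"
  by (simp add: vec_eq_iff ketbra_def gram_nth)

lemma psd_ketbra: "psd (ketbra f)"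
  by (simp only: ketbra_gram psd_gram)

lemma gram_eq_sum_ketbra: "G ** adj G = (\<Sum>k\<in>UNIV. ketbra (column k G))"
  by (simp add: vec_eq_iff gram_nth ketbra_def column_def)

theorem rank_one_measurement_bound:
  fixes \<rho> :: "('a::finite \<times> 'b::finite \<times> 'c::finite) operator" and f :: "'k \<Rightarrow> complex ^ 'b"
  assumes r: "psd \<rho>" and K: "finite K" and f: "(\<Sum>k\<in>K. ketbra (f k)) = mat 1"
  shows "vn_entropy (ptrace_snd (reduced_CB \<rho>)) + (\<Sum>k\<in>K. vn_entropy (cond_op (reduced_AB \<rho>) (ketbra (f k))))
    \<le> vn_entropy (reduced_AB \<rho>) + (\<Sum>k\<in>K. vn_entropy (cond_op (reduced_CB \<rho>) (ketbra (f k))))"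
proof -
  obtain V :: "('a \<times> 'b \<times> 'c) operator" where V: "\<rho> = V ** adj V"
    by (rule psd_eq_gram[OF r])
  \<comment> \<open>The purifying system R is the column index of \<open>V\<close>. Rows of
    \<open>X k\<close> and \<open>Y\<close> are indexed by CR. \<open>X k\<close> holds the
    amplitudes after outcome \<open>k\<close>, with columns indexed by A; \<open>Y\<close> holds
    those before the measurement, with columns indexed by AB.\<close>
  define X :: "'k \<Rightarrow> complex ^ 'a ^ ('c \<times> ('a \<times> 'b \<times> 'c))"
    where "X k = (\<chi> q a. \<Sum>b\<in>UNIV. cnj (f k $ b) * V $ (a, b, fst q) $ snd q)" for k
  define Y :: "complex ^ ('a \<times> 'b) ^ ('c \<times> ('a \<times> 'b \<times> 'c))"
    where "Y = (\<chi> q p. V $ (fst p, snd p, fst q) $ snd q)"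
  let ?CR = "\<lambda>k. X k ** adj (X k)"
  have AB: "reduced_AB \<rho> = transpose Y ** adj (transpose Y)"
    by (simp add: vec_eq_iff reduced_AB_def V gram_nth Y_def transpose_def sum_UNIV_prod[where ?'b = 'c])
  have A: "cond_op (reduced_AB \<rho>) (ketbra (f k)) = transpose (X k) ** adj (transpose (X k))" for k
  proof -
    have "cond_op (reduced_AB \<rho>) (ketbra (f k)) =
       (\<chi> x q. \<Sum>b\<in>UNIV. cnj (f k $ b) * transpose Y $ (x, b) $ snd q) **
        adj (\<chi> x (q :: unit \<times> _). \<Sum>b\<in>UNIV. cnj (f k $ b) * transpose Y $ (x, b) $ snd q)"
      unfolding AB ketbra_gram cond_op_gram by simp
    then show ?thesis
      by (simp add: vec_eq_iff gram_nth X_def Y_def transpose_def sum_UNIV_prod[where ?'b = unit] UNIV_unit)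
  qed
  have C: "cond_op (reduced_CB \<rho>) (ketbra (f k)) = ptrace_snd (?CR k)" for k
  proof -
    define Z :: "complex ^ ('a \<times> ('a \<times> 'b \<times> 'c)) ^ ('c \<times> 'b)"
      where "Z = (\<chi> p q. V $ (fst q, snd p, fst p) $ snd q)"
    have CB: "reduced_CB \<rho> = Z ** adj Z"
      by (simp add: vec_eq_iff reduced_CB_def V gram_nth Z_def sum_UNIV_prod[where ?'b = 'a])
    have "cond_op (reduced_CB \<rho>) (ketbra (f k)) =
       (\<chi> x q. \<Sum>b\<in>UNIV. cnj (f k $ b) * Z $ (x, b) $ snd q) **
        adj (\<chi> x (q :: unit \<times> _). \<Sum>b\<in>UNIV. cnj (f k $ b) * Z $ (x, b) $ snd q)"
      unfolding CB ketbra_gram cond_op_gram by simp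
    then have "cond_op (reduced_CB \<rho>) (ketbra (f k)) $ x $ y =
        (\<Sum>p\<in>UNIV. X k $ (x, snd p) $ fst p * cnj (X k $ (y, snd p) $ fst p))" for x y
      by (simp add: gram_nth X_def Z_def sum_UNIV_prod[where ?'b = unit] UNIV_unit)
    also have "\<dots> x y = (\<Sum>a\<in>UNIV. \<Sum>r\<in>UNIV. X k $ (x, r) $ a * cnj (X k $ (y, r) $ a))" for x y
      unfolding sum_UNIV_prod[where ?'b = 'a and ?'c = "'a \<times> 'b \<times> 'c"] by simp
    also have "\<dots> x y = ptrace_snd (?CR k) $ x $ y" for x y
      by (subst sum.swap) (simp add: ptrace_snd_def gram_nth)
    finally show ?thesis by (simp add: vec_eq_iff)
  qed
  have CR: "(\<Sum>k\<in>K. ?CR k) = Y ** adj Y"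
  proof -
    have "(\<Sum>k\<in>K. ?CR k) $ p $ q = (Y ** adj Y) $ p $ q" for p q
    proof -
      \<comment> \<open>Completeness of the measurement identifies the two indices of B. Summing
        over outcomes therefore gives back the unmeasured marginal on CR.\<close>
      have k: "(\<Sum>k\<in>K. cnj (f k $ b) * f k $ b') = (if b = b' then 1 else 0)" for b b'
      proof -
        have "(\<Sum>k\<in>K. ketbra (f k)) $ b' $ b = mat 1 $ b' $ b" by (simp add: f)
        then show ?thesis by (auto simp: ketbra_def mat_def mult.commute)
      qed
      have "(\<Sum>k\<in>K. ?CR k) $ p $ q = (\<Sum>k\<in>K. \<Sum>a\<in>UNIV. \<Sum>b\<in>UNIV. \<Sum>b'\<in>UNIV.
          cnj (f k $ b) * V $ (a, b, fst p) $ snd p * (f k $ b' * cnj (V $ (a, b', fst q) $ snd q)))"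
        by (simp add: gram_nth X_def sum_product)
      also have "\<dots> = (\<Sum>a\<in>UNIV. \<Sum>b\<in>UNIV. \<Sum>b'\<in>UNIV. \<Sum>k\<in>K.
          cnj (f k $ b) * V $ (a, b, fst p) $ snd p * (f k $ b' * cnj (V $ (a, b', fst q) $ snd q)))"
        by (simp only: sum.swap[of _ _ K])
      also have "\<dots> = (\<Sum>a\<in>UNIV. \<Sum>b\<in>UNIV. \<Sum>b'\<in>UNIV.
          (\<Sum>k\<in>K. cnj (f k $ b) * f k $ b') * (V $ (a, b, fst p) $ snd p * cnj (V $ (a, b', fst q) $ snd q)))"
        by (simp add: sum_distrib_left sum_distrib_right mult_ac)
      also have "\<dots> = (\<Sum>a\<in>UNIV. \<Sum>b\<in>UNIV. V $ (a, b, fst p) $ snd p * cnj (V $ (a, b, fst q) $ snd q))"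
        unfolding k by (simp add: if_distribR if_distrib cong: if_cong)
      also have "\<dots> = (Y ** adj Y) $ p $ q"
        by (simp add: gram_nth Y_def sum_UNIV_prod[where ?'b = 'a])
      finally show ?thesis .
    qed
    then show ?thesis by (simp add: vec_eq_iff)
  qed
  have C': "ptrace_snd (reduced_CB \<rho>) = ptrace_snd (\<Sum>k\<in>K. ?CR k)"
  proof -
    have "ptrace_snd (reduced_CB \<rho>) $ x $ y = ptrace_snd (Y ** adj Y) $ x $ y" for x y
    proof -
      have "ptrace_snd (reduced_CB \<rho>) $ x $ y =
          (\<Sum>(b, a, r)\<in>UNIV. V $ (a, b, x) $ r * cnj (V $ (a, b, y) $ r))"
        by (simp add: ptrace_snd_def reduced_CB_def V gram_nth sum_UNIV_prod[where ?'b = 'b] sum_UNIV_prod[where ?'b = 'a and ?'c = "'a \<times> 'b \<times> 'c"])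
      also have "\<dots> = (\<Sum>(r, a, b)\<in>UNIV. V $ (a, b, x) $ r * cnj (V $ (a, b, y) $ r))"
        by (rule sum.reindex_bij_witness[of _ "\<lambda>(r, a, b). (b, a, r)" "\<lambda>(b, a, r). (r, a, b)"]) auto
      also have "\<dots> = ptrace_snd (Y ** adj Y) $ x $ y"
        by (simp add: ptrace_snd_def gram_nth Y_def sum_UNIV_prod)
      finally show ?thesis .
    qed
    then show ?thesis unfolding CR by (simp add: vec_eq_iff)
  qed
  have pt: "ptrace_snd (\<Sum>k\<in>K. ?CR k) = (\<Sum>k\<in>K. ptrace_snd (?CR k))"
    by (simp add: vec_eq_iff ptrace_snd_def sum.swap[of _ _ K])
  \<comment> \<open>Monotonicity under discarding R, for each outcome against the sum of all
    outcomes.\<close>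
  have "(\<Sum>k\<in>K. rel_entropy (ptrace_snd (?CR k)) (ptrace_snd (\<Sum>k\<in>K. ?CR k)))
      \<le> (\<Sum>k\<in>K. rel_entropy (?CR k) (\<Sum>k\<in>K. ?CR k))"
    using K by (intro sum_mono rel_entropy_ptrace_mono psd_gram psd_sum psd_sum_diff)
  then have "vn_entropy (ptrace_snd (\<Sum>k\<in>K. ?CR k)) - (\<Sum>k\<in>K. vn_entropy (ptrace_snd (?CR k)))
      \<le> vn_entropy (\<Sum>k\<in>K. ?CR k) - (\<Sum>k\<in>K. vn_entropy (?CR k))"
    unfolding pt sum_rel_entropy .
  moreover have "vn_entropy (cond_op (reduced_AB \<rho>) (ketbra (f k))) = vn_entropy (?CR k)" for k
    unfolding A by (rule vn_entropy_complementary [symmetric])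
  moreover have "vn_entropy (reduced_AB \<rho>) = vn_entropy (\<Sum>k\<in>K. ?CR k)"
    unfolding AB CR by (rule vn_entropy_complementary [symmetric])
  ultimately show ?thesis by (simp add: C C')
qed

section \<open>Reduced states of the tripartite operator\<close>

lemma ptrace_fst_reduced_AB: "ptrace_fst (reduced_AB \<rho>) = reduced_B \<rho>"
  by (simp add: vec_eq_iff ptrace_fst_def reduced_AB_def reduced_B_def sum_UNIV_prod)

lemma psd_reduced_AB:
  fixes \<rho> :: "('a::finite \<times> 'b::finite \<times> 'c::finite) operator"
  assumes "psd \<rho>"
  shows "psd (reduced_AB \<rho>)"
proof -
  obtain V :: "('a \<times> 'b \<times> 'c) operator" where V: "\<rho> = V ** adj V"
    by (rule psd_eq_gram[OF assms])
  let ?Y = "(\<chi> p q. V $ (fst p, snd p, fst q) $ snd q) :: complex ^ ('c \<times> ('a \<times> 'b \<times> 'c)) ^ ('a \<times> 'b)"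
  have "reduced_AB \<rho> = ?Y ** adj ?Y"
    by (simp add: vec_eq_iff reduced_AB_def V gram_nth sum_UNIV_prod[where ?'b = 'c])
  then show ?thesis by (simp only: psd_gram)
qed

lemma psd_reduced_CB:
  fixes \<rho> :: "('a::finite \<times> 'b::finite \<times> 'c::finite) operator"
  assumes "psd \<rho>"
  shows "psd (reduced_CB \<rho>)"
proof -
  obtain V :: "('a \<times> 'b \<times> 'c) operator" where V: "\<rho> = V ** adj V"
    by (rule psd_eq_gram[OF assms])
  let ?Y = "(\<chi> p q. V $ (fst q, snd p, fst p) $ snd q) :: complex ^ ('a \<times> ('a \<times> 'b \<times> 'c)) ^ ('c \<times> 'b)"
  have "reduced_CB \<rho> = ?Y ** adj ?Y"
    by (simp add: vec_eq_iff reduced_CB_def V gram_nth sum_UNIV_prod[where ?'b = 'a])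
  then show ?thesis by (simp only: psd_gram)
qed

text \<open>Both sides depend only on the shared marginal on B. The trace terms of the scaled
  entropies of A and C thus agree outcome by outcome.\<close>

lemma trace_reduced:
  "trace (cond_op (reduced_AB \<rho>) F) = trace (cond_op (reduced_CB \<rho>) F)"
proof -
  have "trace (cond_op (reduced_AB \<rho>) F) = (\<Sum>(a, b, b', c)\<in>UNIV. F $ b $ b' * \<rho> $ (a, b', c) $ (a, b, c))"
    by (simp add: trace_def cond_op_nth reduced_AB_def sum_UNIV_prod sum_distrib_left)
  also have "\<dots> = (\<Sum>(c, b, b', a)\<in>UNIV. F $ b $ b' * \<rho> $ (a, b', c) $ (a, b, c))"
    by (rule sum.reindex_bij_witness[of _ "\<lambda>(c, b, b', a). (a, b, b', c)" "\<lambda>(a, b, b', c). (c, b, b', a)"]) auto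
  also have "\<dots> = trace (cond_op (reduced_CB \<rho>) F)"
    by (simp add: trace_def cond_op_nth reduced_CB_def sum_UNIV_prod sum_distrib_left)
  finally show ?thesis .
qed

theorem mainTheorem3:
  fixes \<rho> :: "('a::finite \<times> 'b::finite \<times> 'c::finite) operator"
  assumes "density_operator \<rho>"
  shows "discord (reduced_AB \<rho>) + classical_correlation (reduced_CB \<rho>) \<le> vn_entropy (reduced_B \<rho>)"
proof -
  have r: "psd \<rho>" using assms by (simp add: density_operator_def)
  let ?AB = "reduced_AB \<rho>" and ?CB = "reduced_CB \<rho>"
  \<comment> \<open>Unfolding the discord cancels the entropy of B, and the theorem becomes an upper
    bound on the classical correlation of CB. It suffices to prove it for each POVM.\<close>
  have "info_gain ?CB n E \<le> vn_entropy ?AB - vn_entropy (ptrace_snd ?AB) + classical_correlation ?AB"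
    if E: "povm n E" for n E
  proof -
    have "\<exists>G :: 'b operator. E i = G ** adj G" if "i < n" for i
      using E that psd_eq_gram[of "E i"] by (metis povm_def)
    then obtain G :: "nat \<Rightarrow> 'b operator" where G: "\<And>i. i < n \<Longrightarrow> E i = G i ** adj (G i)"
      by metis
    \<comment> \<open>Outcomes of the refined measurement: the original outcome together with a
      column of its Gram factor.\<close>
    define K where "K = {..<n} \<times> (UNIV :: 'b set)"
    define f where "f p = column (snd p) (G (fst p))" for p
    have Esum: "E i = (\<Sum>b\<in>UNIV. ketbra (f (i, b)))" if "i < n" for i
      using that by (simp add: G f_def gram_eq_sum_ketbra)
    have "finite K" by (simp add: K_def)
    have f1: "(\<Sum>p\<in>K. ketbra (f p)) = mat 1"
    proof -
      have "(\<Sum>p\<in>K. ketbra (f p)) = (\<Sum>i<n. E i)"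
        by (simp add: K_def Esum sum.cartesian_product)
      then show ?thesis using E by (simp add: povm_def)
    qed
    \<comment> \<open>\<open>povm\<close> numbers its outcomes by naturals, so the pairs in
      \<open>K\<close> are enumerated.\<close>
    obtain h where h: "bij_betw h {..<card K} K"
      using ex_bij_betw_nat_finite[OF \<open>finite K\<close>] by (auto simp: atLeast0LessThan)
    define F where "F k = ketbra (f (h k))" for k
    have F: "povm (card K) F"
      by (simp add: povm_def F_def psd_ketbra sum.reindex_bij_betw[OF h, of "\<lambda>p. ketbra (f p)"] f1)
    let ?g = "\<lambda>\<tau> p. scaled_entropy (cond_op \<tau> (ketbra (f p)))"
    have "(\<Sum>p\<in>K. ?g ?CB p) = (\<Sum>i<n. \<Sum>b\<in>UNIV. ?g ?CB (i, b))"
      by (simp add: K_def sum.cartesian_product)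
    also have "\<dots> \<le> (\<Sum>i<n. scaled_entropy (cond_op ?CB (E i)))"
    proof (intro sum_mono)
      fix i assume "i \<in> {..<n}"
      then show "(\<Sum>b\<in>UNIV. ?g ?CB (i, b)) \<le> scaled_entropy (cond_op ?CB (E i))"
        by (simp add: Esum cond_op_sum)
          (intro scaled_entropy_sum_le finite psd_cond_op psd_reduced_CB psd_ketbra r)
    qed
    finally have 1: "info_gain ?CB n E \<le> vn_entropy (ptrace_snd ?CB) - (\<Sum>p\<in>K. ?g ?CB p)"
      using E by (subst info_gain_eq) (auto simp: povm_def intro: psd_reduced_CB r)
    have "info_gain ?AB (card K) F = vn_entropy (ptrace_snd ?AB) - (\<Sum>k<card K. ?g ?AB (h k))"
      using F by (subst info_gain_eq) (auto simp: povm_def F_def intro: psd_reduced_AB r)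
    also have "(\<Sum>k<card K. ?g ?AB (h k)) = (\<Sum>p\<in>K. ?g ?AB p)"
      by (rule sum.reindex_bij_betw[OF h])
    finally have 2: "vn_entropy (ptrace_snd ?AB) - (\<Sum>p\<in>K. ?g ?AB p) \<le> classical_correlation ?AB"
      using info_gain_le_classical_correlation[OF psd_reduced_AB[OF r] F] by simp
    \<comment> \<open>The rank-one bound speaks of \<open>vn_entropy\<close>. Passing to
      \<open>scaled_entropy\<close> adds the same trace terms on both sides.\<close>
    have "vn_entropy (ptrace_snd ?CB) + (\<Sum>p\<in>K. ?g ?AB p) \<le> vn_entropy ?AB + (\<Sum>p\<in>K. ?g ?CB p)"
      using rank_one_measurement_bound[OF r \<open>finite K\<close> f1]
      by (simp add: scaled_entropy_def sum.distrib trace_reduced)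
    with 1 2 show ?thesis by simp
  qed
  then have "classical_correlation ?CB \<le> vn_entropy ?AB - vn_entropy (ptrace_snd ?AB) + classical_correlation ?AB"
    by (rule classical_correlation_le)
  then show ?thesis
    by (simp add: discord_def mutual_information_def ptrace_fst_reduced_AB)
qed

end
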